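(* Let $\Gamma$ be a weighted digraph without loops on $V(\Gamma)=\{1,\dots,n\}$, $n>1$, with column Laplacian matrix $L$, out-forest dimension $d'$, source knots $K_1,\dots,K_{d'}$, and stochastic matrix of maximum out-forests $\tilde J$. Then every column of $\tilde J$ is a solution of $Lx=0$. Suppose moreover that the numeration of vertices is standard, i.e., the vertices of $K_1$ receive the smallest numbers, the vertices of $K_2$ the next numbers, and so on, and the vertices of $V(\Gamma)\setminus\bigcup_{s}K_s$ the largest numbers; write $K_s=\{i_s+1,\dots,i_s+k_s\}$. Let $j_1\in K_1,\dots,j_{d'}\in K_{d'}$. Then the columns $\tilde J_{\bullet j_1},\dots,\tilde J_{\bullet j_{d'}}$ of $\tilde J$ form an orthogonal basis of the space of (real) solutions of $Lx=0$, and for each $s=1,\dots,d'$, $$\tilde J_{\bullet j_s}=w(\mathcal{T}_s)^{-1}\bigl(0,\dots,0,\,w(\mathcal{T}_s^{i_s+1}),\dots,w(\mathcal{T}_s^{i_s+k_s}),\,0,\dots,0\bigr)^T,$$ where the nonzero entries occupy the positions $i_s+1,\dots,i_s+k_s$.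
   Context: A weighted digraph $\Gamma$ has arcs $(i,j)$ with weights $w_{ij}>0$ ($w_{ij}=0$ if there is no arc from $i$ to $j$), no loops. The column Laplacian $L=(l_{ij})$ has $l_{ij}=-w_{ij}$ for $j\neq i$ and $l_{ii}=\sum_{k\neq i}w_{ki}$ (zero column sums). The weight of a subgraph is the product of its arc weights (1 if it has no arcs); the weight of a set of subgraphs is the sum of their weights ($0$ for the empty set). A diverging tree is a weakly connected digraph with one vertex (root) of indegree $0$ and all others of indegree $1$; an out-forest of $\Gamma$ is a spanning subgraph whose weak components are diverging trees. The out-forest dimension $d'$ is the minimum number of trees in an out-forest of $\Gamma$; maximum out-forests are those with $n-d'$ arcs. $\tilde J=(\tilde J_{ij})$ has entries $\tilde J_{ij}=w(\mathcal{F}^{i*\to j}_{n-d'})/w(\mathcal{F}_{n-d'})$, where $\mathcal{F}_{n-d'}$ is the set of out-forests with $n-d'$ arcs and $\mathcal{F}^{i*\to j}_{n-d'}$ its subset of forests in which $j$ lies in the tree rooted at $i$. A source knot is the vertex set of a strong component of $\Gamma$ into which no arc enters from outside the component. For a source knot $K_s$, $\mathcal{T}_s$ is the set of spanning diverging trees of the restriction $\Gamma_{K_s}$ of $\Gamma$ to $K_s$, and $\mathcal{T}_s^{m}$ ($m\in K_s$) the subset of those trees rooted at $m$. $\tilde J_{\bullet j}$ denotes the $j$th column of $\tilde J$. *)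

theory Defs
  imports "HOL-Analysis.Analysis" "Graph_Theory.Digraph_Component"
begin

text \<open>
  The vertex set is a finite type \<open>'n\<close>. A weighted digraph is given by its weights \<open>w i j\<close>,
  with \<open>w i j = 0\<close> when there is no arc from \<open>i\<close> to \<open>j\<close>.
\<close>

definition weighted_digraph :: "('n \<Rightarrow> 'n \<Rightarrow> real) \<Rightarrow> bool" where
  "weighted_digraph w \<longleftrightarrow> (\<forall>i j. 0 \<le> w i j) \<and> (\<forall>i. w i i = 0)"

definition digraph_of :: "('n \<Rightarrow> 'n \<Rightarrow> real) \<Rightarrow> ('n, 'n \<times> 'n) pre_digraph" where
  "digraph_of w = \<lparr>verts = UNIV, arcs = {(i, j). w i j > 0}, tail = fst, head = snd\<rparr>"

definition laplacian :: "('n::finite \<Rightarrow> 'n \<Rightarrow> real) \<Rightarrow> real ^ 'n ^ 'n" where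
  "laplacian w = (\<chi> i j. if i = j then \<Sum>k\<in>UNIV - {i}. w k i else - w i j)"

definition weight :: "('n \<Rightarrow> 'n \<Rightarrow> real) \<Rightarrow> ('n, 'n \<times> 'n) pre_digraph \<Rightarrow> real" where
  "weight w H = (\<Prod>(i, j)\<in>arcs H. w i j)"

definition set_weight :: "('n \<Rightarrow> 'n \<Rightarrow> real) \<Rightarrow> ('n, 'n \<times> 'n) pre_digraph set \<Rightarrow> real" where
  "set_weight w S = (\<Sum>H\<in>S. weight w H)"

text \<open>
  The constant \<open>Digraph_Component.connected\<close> is weak connectivity (strong connectivity of the
  symmetrised digraph); the qualified name avoids the topological constant \<open>connected\<close>.
\<close>

definition weak_components :: "('a, 'b) pre_digraph \<Rightarrow> ('a, 'b) pre_digraph set" where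
  "weak_components G = {H. pre_digraph.max_subgraph G Digraph_Component.connected H}"

definition diverging_tree :: "('a, 'b) pre_digraph \<Rightarrow> 'a \<Rightarrow> bool" where
  "diverging_tree T r \<longleftrightarrow> Digraph_Component.connected T \<and> r \<in> verts T \<and> in_degree T r = 0
     \<and> (\<forall>v\<in>verts T - {r}. in_degree T v = 1)"

definition out_forests :: "('a, 'b) pre_digraph \<Rightarrow> ('a, 'b) pre_digraph set" where
  "out_forests G = {F. spanning F G \<and> (\<forall>T\<in>weak_components F. \<exists>r. diverging_tree T r)}"

definition out_forest_dim :: "('a, 'b) pre_digraph \<Rightarrow> nat" where
  "out_forest_dim G = (LEAST d. \<exists>F\<in>out_forests G. card (weak_components F) = d)"

definition max_out_forests :: "('a, 'b) pre_digraph \<Rightarrow> ('a, 'b) pre_digraph set" where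
  "max_out_forests G = {F \<in> out_forests G. card (arcs F) = card (verts G) - out_forest_dim G}"

definition max_out_forests_from_to ::
    "('a, 'b) pre_digraph \<Rightarrow> 'a \<Rightarrow> 'a \<Rightarrow> ('a, 'b) pre_digraph set" where
  "max_out_forests_from_to G i j =
     {F \<in> max_out_forests G. \<exists>T\<in>weak_components F. diverging_tree T i \<and> j \<in> verts T}"

definition max_forest_matrix :: "('n::finite \<Rightarrow> 'n \<Rightarrow> real) \<Rightarrow> real ^ 'n ^ 'n" where
  "max_forest_matrix w = (\<chi> i j. set_weight w (max_out_forests_from_to (digraph_of w) i j)
     / set_weight w (max_out_forests (digraph_of w)))"

definition source_knots :: "('a, 'b) pre_digraph \<Rightarrow> 'a set set" where
  "source_knots G = {verts C | C. C \<in> pre_digraph.sccs G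
     \<and> \<not> (\<exists>u v. u \<notin> verts C \<and> v \<in> verts C \<and> (u, v) \<in> arcs_ends G)}"

definition spanning_diverging_trees :: "('a, 'b) pre_digraph \<Rightarrow> ('a, 'b) pre_digraph set" where
  "spanning_diverging_trees G = {T. spanning T G \<and> (\<exists>r. diverging_tree T r)}"

definition spanning_diverging_trees_at ::
    "('a, 'b) pre_digraph \<Rightarrow> 'a \<Rightarrow> ('a, 'b) pre_digraph set" where
  "spanning_diverging_trees_at G m = {T. spanning T G \<and> diverging_tree T m}"

text \<open>
  A numeration assigns the numbers \<open>1, \<dots>, n\<close> bijectively to the vertices. It is standard for
  the sets \<open>K 1, \<dots>, K d\<close> if the vertices of \<open>K 1\<close> come first, then those of \<open>K 2\<close>, and so on,
  and the vertices outside all \<open>K s\<close> come last.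
\<close>

definition standard_numeration :: "('n::finite \<Rightarrow> nat) \<Rightarrow> nat \<Rightarrow> (nat \<Rightarrow> 'n set) \<Rightarrow> bool" where
  "standard_numeration num d K \<longleftrightarrow>
     bij_betw num UNIV {1..CARD('n)}
     \<and> (\<forall>s\<in>{1..d}. \<forall>t\<in>{1..d}. s < t \<longrightarrow> (\<forall>u\<in>K s. \<forall>v\<in>K t. num u < num v))
     \<and> (\<forall>u\<in>(\<Union>s\<in>{1..d}. K s). \<forall>v\<in>UNIV - (\<Union>s\<in>{1..d}. K s). num u < num v)"

end

theory Submission
  imports Defs
begin

text \<open>
  An out-forest is determined by its arc set, which is acyclic with at most one arc entering each
  vertex. Source knots are closed under predecessors, so every out-forest has a root in each of
  them, and the maximum out-forests are those with exactly one root per knot and no other roots.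
  Exchanging the part of such a forest inside a knot \<open>K\<close> for any other spanning diverging tree of
  \<open>K\<close> gives a maximum out-forest again, so forest weights factor into the weight of a tree on \<open>K\<close>
  and the weight of the remaining arcs; hence on each knot the columns of \<open>J\<close> are proportional to the
  vector of tree weights \<open>w(T\<^sub>s\<^sup>m)\<close>, which is harmonic by the Markov chain tree theorem.

  Conversely, if \<open>Lx = 0\<close> then also \<open>L\<bar>x\<bar> = 0\<close>. The support of \<open>x\<close> is then closed under
  predecessors and contained in the union of the knots, so \<open>x\<close> vanishes as soon as it has a zero in
  every knot. This bounds the dimension of the kernel without a rank computation.
\<close>

section \<open>Out-forests as arc sets\<close>

text \<open>Arcs that are pairs with projections as tail and head carry no data beyond the relation
  itself. Every subgraph of such a digraph has the same form, so graph notions turn into statements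
  about relations.\<close>

definition arc_digraph :: "'a set \<Rightarrow> 'a rel \<Rightarrow> ('a, 'a \<times> 'a) pre_digraph" where
  "arc_digraph V A = \<lparr>verts = V, arcs = A, tail = fst, head = snd\<rparr>"

text \<open>Single-valuedness of the converse says that at most one arc enters each vertex. The
  roots are the vertices outside \<open>Range A\<close>, including the isolated ones.\<close>

definition branching :: "'a rel \<Rightarrow> bool" where
  "branching A \<longleftrightarrow> single_valued (A\<inverse>) \<and> acyclic A"

text \<open>Directed reachability from the root takes the place of weak connectivity and indegree
  one; acyclicity is derived from it.\<close>

definition arborescence :: "'a set \<Rightarrow> 'a \<Rightarrow> 'a rel \<Rightarrow> bool" where
  "arborescence V r A \<longleftrightarrow> A \<subseteq> V \<times> V \<and> single_valued (A\<inverse>) \<and> r \<in> V \<and> r \<notin> Range A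
     \<and> (\<forall>v\<in>V. (r, v) \<in> A\<^sup>*)"

definition weak_class :: "'a rel \<Rightarrow> 'a \<Rightarrow> 'a set" where
  "weak_class A v = (A \<union> A\<inverse>)\<^sup>* `` {v}"

lemma arc_digraph_simps [simp]:
  "verts (arc_digraph V A) = V" "arcs (arc_digraph V A) = A"
  "tail (arc_digraph V A) = fst" "head (arc_digraph V A) = snd"
  by (simp_all add: arc_digraph_def)

lemma arc_digraph_eq_iff [simp]:
  "arc_digraph V A = arc_digraph V' A' \<longleftrightarrow> V = V' \<and> A = A'"
  by (auto simp: arc_digraph_def)

lemma arcs_ends_arc_digraph [simp]: "arcs_ends (arc_digraph V A) = A"
  by (simp add: arcs_ends_conv)

lemma wf_arc_digraph [simp]: "wf_digraph (arc_digraph V A) \<longleftrightarrow> A \<subseteq> V \<times> V"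
  by (fastforce simp: wf_digraph_def)

section \<open>Subgraphs, weak connectivity and indegrees in terms of relations\<close>

lemma subgraph_arc_digraph_iff:
  assumes "A \<subseteq> V \<times> V"
  shows "subgraph H (arc_digraph V A)
    \<longleftrightarrow> (\<exists>V' A'. H = arc_digraph V' A' \<and> V' \<subseteq> V \<and> A' \<subseteq> A \<and> A' \<subseteq> V' \<times> V')"
proof
  assume H: "subgraph H (arc_digraph V A)"
  have "H = arc_digraph (verts H) (arcs H)"
    using H by (auto simp: subgraph_def compatible_def arc_digraph_def)
  moreover have "verts H \<subseteq> V" "arcs H \<subseteq> A" "wf_digraph H"
    using H by (auto simp: subgraph_def)
  ultimately show "\<exists>V' A'. H = arc_digraph V' A' \<and> V' \<subseteq> V \<and> A' \<subseteq> A \<and> A' \<subseteq> V' \<times> V'"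
    by (metis wf_arc_digraph)
next
  assume "\<exists>V' A'. H = arc_digraph V' A' \<and> V' \<subseteq> V \<and> A' \<subseteq> A \<and> A' \<subseteq> V' \<times> V'"
  then show "subgraph H (arc_digraph V A)"
    using assms by (auto simp: subgraph_def compatible_def)
qed

lemma spanning_arc_digraph_iff:
  assumes "A \<subseteq> V \<times> V"
  shows "spanning H (arc_digraph V A) \<longleftrightarrow> (\<exists>A'\<subseteq>A. H = arc_digraph V A')"
  using assms unfolding spanning_def subgraph_arc_digraph_iff[OF assms] by auto

lemma connected_arc_digraph_iff:
  assumes "A \<subseteq> V \<times> V"
  shows "Digraph_Component.connected (arc_digraph V A)
    \<longleftrightarrow> V \<noteq> {} \<and> (\<forall>u\<in>V. \<forall>v\<in>V. (u, v) \<in> (A \<union> A\<inverse>)\<^sup>*)"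
proof -
  have sym: "A\<^sup>s = A \<union> A\<inverse>"
    by (auto simp: symcl_def)
  have "(u, v) \<in> rtrancl_on V (A\<^sup>s) \<longleftrightarrow> (u, v) \<in> (A \<union> A\<inverse>)\<^sup>*" if "u \<in> V" "v \<in> V" for u v
    unfolding sym using that assms
    by (blast intro: rtrancl_consistent_rtrancl_on rtrancl_on_rtranclI)
  then show ?thesis
    unfolding connected_conv by simp
qed

lemma in_degree_arc_digraph:
  "in_degree (arc_digraph V A) v = card {u. (u, v) \<in> A}"
proof -
  have "in_arcs (arc_digraph V A) v = (\<lambda>u. (u, v)) ` {u. (u, v) \<in> A}"
    by (auto simp: in_arcs_def)
  then show ?thesis
    by (simp add: in_degree_def card_image inj_on_def)
qed

lemma single_valued_converseD:
  "single_valued (A\<inverse>) \<Longrightarrow> (u, v) \<in> A \<Longrightarrow> (u', v) \<in> A \<Longrightarrow> u = u'"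
  by (auto simp: single_valued_def)

text \<open>The last arc of a nonempty path into \<open>v\<close> must be the only arc entering
  \<open>v\<close>.\<close>

lemma rtrancl_pred_step:
  assumes "single_valued (A\<inverse>)" "(r, v) \<in> A\<^sup>*" "r \<noteq> v" "(u, v) \<in> A"
  shows "(r, u) \<in> A\<^sup>*"
  using assms by (metis rtranclE single_valued_converseD)

text \<open>A cycle can be pulled back along the path from the root: the only predecessor of a
  vertex on a cycle lies on a cycle too. The root would then lie on a cycle and have an entering
  arc.\<close>

lemma arborescence_acyclic:
  assumes "arborescence V r A"
  shows "acyclic A"
proof (rule acyclicI, intro allI notI)
  fix v assume cyc: "(v, v) \<in> A\<^sup>+"
  have A: "A \<subseteq> V \<times> V" "single_valued (A\<inverse>)" "r \<notin> Range A" "\<forall>v\<in>V. (r, v) \<in> A\<^sup>*"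
    using assms by (auto simp: arborescence_def)
  have "v \<in> V"
    using cyc A(1) by (meson SigmaD2 subsetD tranclE)
  then have "(r, v) \<in> A\<^sup>*"
    using A(4) by blast
  then show False
    using cyc
  proof (induction rule: rtrancl_induct)
    case base
    then show ?case using A(3) by (meson Range.intros tranclE)
  next
    case (step y z)
    obtain u where "(z, u) \<in> A\<^sup>*" "(u, z) \<in> A"
      using step.prems by (meson tranclD2)
    then have "(z, y) \<in> A\<^sup>*"
      using A(2) step.hyps(2) by (metis single_valued_converseD)
    then show ?case
      using step.IH step.hyps(2) by (meson rtrancl_into_trancl2)
  qed
qed

lemma arborescence_root_unique:
  assumes "arborescence V r A" "arborescence V r' A"
  shows "r = r'"
proof -
  have "(r', r) \<in> A\<^sup>*" "r \<notin> Range A"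
    using assms by (auto simp: arborescence_def)
  then show ?thesis by (metis Range.intros rtranclE)
qed

text \<open>An undirected path from the root can be made directed. A backward step from
  \<open>y\<close> goes to the only predecessor of \<open>y\<close>, which the directed path to
  \<open>y\<close> has already passed, as \<open>y\<close> is not the root. Finiteness of
  \<open>V\<close> makes indegree 0 mean that no arc enters.\<close>

lemma diverging_tree_arc_digraph_iff:
  assumes "finite V" and AV: "A \<subseteq> V \<times> V"
  shows "diverging_tree (arc_digraph V A) r \<longleftrightarrow> arborescence V r A"
proof -
  have fin: "finite {u. (u, v) \<in> A}" for v
    by (rule finite_subset[OF _ assms(1)]) (use AV in auto)
  have deg0: "card {u. (u, v) \<in> A} = 0 \<longleftrightarrow> v \<notin> Range A" for v
    using fin by auto
  have deg1: "card {u. (u, v) \<in> A} = 1 \<longleftrightarrow> (\<exists>!u. (u, v) \<in> A)" for v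
    unfolding card_1_singleton_iff One_nat_def set_eq_iff by (auto; metis)
  have tree: "diverging_tree (arc_digraph V A) r \<longleftrightarrow>
      (\<forall>u\<in>V. \<forall>v\<in>V. (u, v) \<in> (A \<union> A\<inverse>)\<^sup>*) \<and> r \<in> V \<and> r \<notin> Range A \<and> (\<forall>v\<in>V - {r}. \<exists>!u. (u, v) \<in> A)"
    unfolding diverging_tree_def connected_arc_digraph_iff[OF AV] in_degree_arc_digraph deg0 deg1
      arc_digraph_simps by blast
  show ?thesis
  proof
    assume "diverging_tree (arc_digraph V A) r"
    then have conn: "\<And>v. v \<in> V \<Longrightarrow> (r, v) \<in> (A \<union> A\<inverse>)\<^sup>*" and r: "r \<in> V" "r \<notin> Range A"
      and ex1: "\<And>v. v \<in> V \<Longrightarrow> v \<noteq> r \<Longrightarrow> \<exists>!u. (u, v) \<in> A"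
      unfolding tree by blast+
    have sv: "single_valued (A\<inverse>)"
    proof -
      have "u = u'" if "(u, v) \<in> A" "(u', v) \<in> A" for u u' v
        using that ex1[of v] r(2) AV by (metis Range.intros SigmaD2 subsetD)
      then show ?thesis by (auto simp: single_valued_def)
    qed
    have "(r, v) \<in> A\<^sup>*" if "(r, v) \<in> (A \<union> A\<inverse>)\<^sup>*" for v
      using that
    proof (induction rule: rtrancl_induct)
      case (step y z)
      then show ?case
        using r(2) by (metis Range.intros UnE converseD rtrancl.rtrancl_into_rtrancl rtrancl_pred_step sv)
    qed simp
    then show "arborescence V r A"
      using AV sv r conn by (auto simp: arborescence_def)
  next
    assume *: "arborescence V r A"
    then have reach: "\<And>v. v \<in> V \<Longrightarrow> (r, v) \<in> A\<^sup>*"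
      by (auto simp: arborescence_def)
    have "(u, v) \<in> (A \<union> A\<inverse>)\<^sup>*" if "u \<in> V" "v \<in> V" for u v
    proof -
      have "(r, v) \<in> (A \<union> A\<inverse>)\<^sup>*" "(u, r) \<in> (A \<union> A\<inverse>)\<^sup>*"
        using reach that by (meson in_mono rtrancl_mono sup_ge1 sup_ge2 rtrancl_converseI)+
      then show ?thesis by (rule rtrancl_trans[rotated])
    qed
    moreover have "\<exists>!u. (u, v) \<in> A" if "v \<in> V" "v \<noteq> r" for v
      using reach[OF that(1)] that(2) * unfolding arborescence_def
      by (metis rtranclE single_valued_converseD)
    ultimately show "diverging_tree (arc_digraph V A) r"
      using * unfolding tree arborescence_def by blast
  qed
qed

section \<open>Weak components\<close>

lemma weak_class_refl [simp]: "v \<in> weak_class A v"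
  by (simp add: weak_class_def)

lemma weak_class_step:
  "(u, v) \<in> A \<Longrightarrow> u \<in> weak_class A x \<longleftrightarrow> v \<in> weak_class A x"
  unfolding weak_class_def by (auto intro: rtrancl_into_rtrancl)

lemma weak_class_subset:
  assumes "A \<subseteq> V \<times> V" "v \<in> V"
  shows "weak_class A v \<subseteq> V"
proof
  fix u assume "u \<in> weak_class A v"
  then have "(v, u) \<in> (A \<union> A\<inverse>)\<^sup>*" by (simp add: weak_class_def)
  then show "u \<in> V"
    by (induction rule: rtrancl_induct) (use assms in auto)
qed

lemma sym_rtrancl_Un_converse: "(u, v) \<in> (A \<union> A\<inverse>)\<^sup>* \<Longrightarrow> (v, u) \<in> (A \<union> A\<inverse>)\<^sup>*"
  by (metis converse_Un converse_converse rtrancl_converseI sup_commute)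

lemma weak_class_eq: "u \<in> weak_class A v \<Longrightarrow> weak_class A u = weak_class A v"
  unfolding weak_class_def
  by (metis Image_singleton_iff rtrancl_trans subsetI subset_antisym sym_rtrancl_Un_converse)

definition weak_component :: "'a rel \<Rightarrow> 'a \<Rightarrow> ('a, 'a \<times> 'a) pre_digraph" where
  "weak_component A v = arc_digraph (weak_class A v) (A \<inter> weak_class A v \<times> weak_class A v)"

lemma connected_weak_component: "Digraph_Component.connected (weak_component A v)"
proof -
  let ?C = "weak_class A v"
  let ?B = "A \<inter> ?C \<times> ?C"
  have *: "(v, u) \<in> (?B \<union> ?B\<inverse>)\<^sup>*" if "(v, u) \<in> (A \<union> A\<inverse>)\<^sup>*" for u
    using that
  proof (induction rule: rtrancl_induct)
    case (step y z)
    have "y \<in> ?C" using step.hyps by (simp add: weak_class_def)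
    moreover have "z \<in> ?C" using step.hyps unfolding weak_class_def
      by (auto intro: rtrancl_into_rtrancl)
    ultimately have "(y, z) \<in> ?B \<union> ?B\<inverse>" using step.hyps by auto
    then show ?case using step.IH by (rule rtrancl_into_rtrancl[rotated])
  qed simp
  have "(u, u') \<in> (?B \<union> ?B\<inverse>)\<^sup>*" if "u \<in> ?C" "u' \<in> ?C" for u u'
    using *[of u] *[of u'] that unfolding weak_class_def Image_singleton_iff
    by (meson rtrancl_trans sym_rtrancl_Un_converse)
  moreover have "?C \<noteq> {}" using weak_class_refl by fast
  ultimately show ?thesis
    unfolding weak_component_def by (subst connected_arc_digraph_iff) auto
qed

text \<open>A connected subgraph containing \<open>v\<close> lies inside the subgraph induced on the
  weak class of \<open>v\<close>. These induced subgraphs are connected themselves, hence they are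
  exactly the maximal ones.\<close>

lemma weak_components_arc_digraph:
  assumes AV: "A \<subseteq> V \<times> V"
  shows "weak_components (arc_digraph V A) = weak_component A ` V"
proof -
  let ?F = "arc_digraph V A"
  have sub: "subgraph (weak_component A v) ?F" if "v \<in> V" for v
    using weak_class_subset[OF AV that] unfolding subgraph_arc_digraph_iff[OF AV] weak_component_def
    by auto
  have sub2: "\<exists>V' A'. H = arc_digraph V' A' \<and> V' \<subseteq> weak_class A v
      \<and> A' \<subseteq> A \<inter> weak_class A v \<times> weak_class A v \<and> A' \<subseteq> V' \<times> V'"
    if H: "subgraph H ?F" "Digraph_Component.connected H" "v \<in> verts H" for H v
  proof -
    obtain V' A' where H': "H = arc_digraph V' A'" "V' \<subseteq> V" "A' \<subseteq> A" "A' \<subseteq> V' \<times> V'"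
      using H(1) unfolding subgraph_arc_digraph_iff[OF AV] by auto
    have "(v, u) \<in> (A \<union> A\<inverse>)\<^sup>*" if "u \<in> V'" for u
    proof -
      have "(v, u) \<in> (A' \<union> A'\<inverse>)\<^sup>*"
        using H(2,3) that unfolding H'(1) connected_arc_digraph_iff[OF H'(4)] by auto
      moreover have "A' \<union> A'\<inverse> \<subseteq> A \<union> A\<inverse>" using H'(3) by auto
      ultimately show ?thesis by (meson rtrancl_mono subsetD)
    qed
    then have "V' \<subseteq> weak_class A v" by (auto simp: weak_class_def)
    then show ?thesis using H' by blast
  qed
  show ?thesis
  proof (intro subset_antisym subsetI)
    fix H assume "H \<in> weak_components ?F"
    then have H: "subgraph H ?F" "Digraph_Component.connected H"
      and max: "\<And>H'. H' \<noteq> H \<Longrightarrow> subgraph H H' \<Longrightarrow> subgraph H' ?F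
        \<Longrightarrow> Digraph_Component.connected H' \<Longrightarrow> False"
      by (auto simp: weak_components_def pre_digraph.max_subgraph_def)
    obtain v where v: "v \<in> verts H"
      using H(2) by (auto simp: connected_conv)
    have "v \<in> V" using v H(1) by (auto simp: subgraph_def)
    have "subgraph H (weak_component A v)"
      using sub2[OF H v] unfolding weak_component_def
      by (subst subgraph_arc_digraph_iff) auto
    then have "H = weak_component A v"
      using max sub[OF \<open>v \<in> V\<close>] connected_weak_component by metis
    then show "H \<in> weak_component A ` V"
      using \<open>v \<in> V\<close> by auto
  next
    fix H assume "H \<in> weak_component A ` V"
    then obtain v where v: "v \<in> V" "H = weak_component A v" by auto
    have "H' = H" if H': "subgraph H H'" "subgraph H' ?F" "Digraph_Component.connected H'" for H'
    proof -
      have "v \<in> verts H'"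
        using H'(1) v by (auto simp: subgraph_def weak_component_def)
      from sub2[OF H'(2,3) this] show ?thesis
        using H'(1) v(2) by (auto simp: subgraph_def weak_component_def)
    qed
    then show "H \<in> weak_components ?F"
      using sub v connected_weak_component
      by (auto simp: weak_components_def pre_digraph.max_subgraph_def)
  qed
qed

text \<open>Going back along entering arcs must stop, because a finite acyclic relation is
  well-founded.\<close>

lemma branching_root_exists:
  assumes "branching A" "finite A"
  obtains r where "r \<notin> Range A" "(r, v) \<in> A\<^sup>*"
proof -
  have "wf A"
    using assms by (simp add: branching_def finite_acyclic_wf)
  then have "\<exists>r. r \<notin> Range A \<and> (r, v) \<in> A\<^sup>*"
  proof (induction v rule: wf_induct_rule)
    case (less v)
    then show ?case
      by (cases "v \<in> Range A") (blast intro: rtrancl_into_rtrancl)+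
  qed
  then show ?thesis using that by blast
qed

text \<open>Undirected paths from a root become directed ones by the uniqueness of predecessors, so
  the component of a root is its set of descendants.\<close>

lemma branching_weak_class:
  assumes "branching A" "r \<notin> Range A"
  shows "weak_class A r = A\<^sup>* `` {r}"
proof (intro subset_antisym subsetI)
  fix u assume "u \<in> weak_class A r"
  then have "(r, u) \<in> (A \<union> A\<inverse>)\<^sup>*" by (simp add: weak_class_def)
  then have "(r, u) \<in> A\<^sup>*"
  proof (induction rule: rtrancl_induct)
    case (step y z)
    then show ?case
      using assms unfolding branching_def
      by (metis Range.intros UnE converseD rtrancl.rtrancl_into_rtrancl rtrancl_pred_step)
  qed simp
  then show "u \<in> A\<^sup>* `` {r}" by simp
next
  fix u assume "u \<in> A\<^sup>* `` {r}"
  then show "u \<in> weak_class A r"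
    unfolding weak_class_def by (auto intro: in_rtrancl_UnI)
qed

lemma branching_weak_component:
  assumes "branching A" "r \<notin> Range A"
  shows "arborescence (weak_class A r) r (A \<inter> weak_class A r \<times> weak_class A r)"
proof -
  let ?C = "weak_class A r"
  have "(r, u) \<in> (A \<inter> ?C \<times> ?C)\<^sup>*" if "(r, u) \<in> A\<^sup>*" for u
    using that
  proof (induction rule: rtrancl_induct)
    case (step y z)
    have "y \<in> ?C" using step.hyps assms by (simp add: branching_weak_class)
    then have "(y, z) \<in> A \<inter> ?C \<times> ?C"
      using step.hyps weak_class_step by fastforce
    with step.IH show ?case by (rule rtrancl_into_rtrancl)
  qed simp
  then show ?thesis
    using assms branching_weak_class[OF assms]
    by (auto simp: arborescence_def branching_def single_valued_def)
qed

text \<open>Both defects of a non-branching, a cycle and two arcs with a common head, lie within one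
  weak component. Conversely, the component of any vertex is the component of a root above
  it.\<close>

lemma weak_components_diverging_iff_branching:
  assumes fin: "finite V" and AV: "A \<subseteq> V \<times> V"
  shows "(\<forall>T\<in>weak_components (arc_digraph V A). \<exists>r. diverging_tree T r) \<longleftrightarrow> branching A"
proof -
  have finA: "finite A" using fin AV by (meson finite_SigmaI finite_subset)
  have iff: "(\<exists>r. diverging_tree (weak_component A v) r)
      \<longleftrightarrow> (\<exists>r. arborescence (weak_class A v) r (A \<inter> weak_class A v \<times> weak_class A v))"
    if "v \<in> V" for v
    unfolding weak_component_def using weak_class_subset[OF AV that] fin
    by (subst diverging_tree_arc_digraph_iff) (auto intro: finite_subset)
  show ?thesis
  proof
    assume "\<forall>T\<in>weak_components (arc_digraph V A). \<exists>r. diverging_tree T r"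
    then have arb: "\<exists>r. arborescence (weak_class A v) r (A \<inter> weak_class A v \<times> weak_class A v)"
      if "v \<in> V" for v
      using that iff by (auto simp: weak_components_arc_digraph[OF AV])
    have "u = u'" if "(u, v) \<in> A" "(u', v) \<in> A" for u u' v
    proof -
      have "v \<in> V" using that AV by auto
      moreover have "u \<in> weak_class A v" "u' \<in> weak_class A v"
        using that by (simp_all add: weak_class_step)
      ultimately show ?thesis
        using arb[of v] that by (auto simp: arborescence_def dest: single_valuedD)
    qed
    then have "single_valued (A\<inverse>)"
      by (auto simp: single_valued_def)
    moreover have "acyclic A"
    proof (rule acyclicI, intro allI notI)
      fix v assume cyc: "(v, v) \<in> A\<^sup>+"
      let ?C = "weak_class A v"
      have "u \<in> ?C \<and> (v, u) \<in> (A \<inter> ?C \<times> ?C)\<^sup>+" if "(v, u) \<in> A\<^sup>+" for u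
        using that
      proof (induction rule: trancl_induct)
        case (base y)
        then have "y \<in> ?C" by (metis weak_class_refl weak_class_step)
        then show ?case using base by (simp add: trancl.r_into_trancl)
      next
        case (step y z)
        then have "z \<in> ?C" by (metis weak_class_step)
        then have "(y, z) \<in> A \<inter> ?C \<times> ?C" using step by blast
        then show ?case using step.IH \<open>z \<in> ?C\<close> by (meson trancl.trancl_into_trancl)
      qed
      then have "(v, v) \<in> (A \<inter> ?C \<times> ?C)\<^sup>+" using cyc by blast
      moreover have "v \<in> V" using cyc AV by (meson SigmaD2 subsetD tranclE)
      ultimately show False
        using arb[of v] by (metis acyclic_def arborescence_acyclic)
    qed
    ultimately show "branching A" by (simp add: branching_def)
  next
    assume A: "branching A"
    have "\<exists>r. diverging_tree (weak_component A v) r" if "v \<in> V" for v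
    proof -
      obtain r where r: "r \<notin> Range A" "(r, v) \<in> A\<^sup>*"
        using branching_root_exists[OF A finA] by blast
      then have "v \<in> weak_class A r"
        by (simp add: branching_weak_class[OF A])
      then have "weak_class A v = weak_class A r"
        by (rule weak_class_eq)
      then show ?thesis
        using branching_weak_component[OF A r(1)] iff[OF that] by auto
    qed
    then show "\<forall>T\<in>weak_components (arc_digraph V A). \<exists>r. diverging_tree T r"
      by (auto simp: weak_components_arc_digraph[OF AV])
  qed
qed

lemma weak_component_root_iff:
  assumes fin: "finite V" and AV: "A \<subseteq> V \<times> V" and A: "branching A" and "j \<in> V"
  shows "(\<exists>T\<in>weak_components (arc_digraph V A). diverging_tree T i \<and> j \<in> verts T)
    \<longleftrightarrow> i \<notin> Range A \<and> (i, j) \<in> A\<^sup>*"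
proof -
  have iff: "diverging_tree (weak_component A v) r
      \<longleftrightarrow> arborescence (weak_class A v) r (A \<inter> weak_class A v \<times> weak_class A v)"
    if "v \<in> V" for v r
    unfolding weak_component_def using weak_class_subset[OF AV that] fin
    by (subst diverging_tree_arc_digraph_iff) (auto intro: finite_subset)
  show ?thesis
  proof
    assume "\<exists>T\<in>weak_components (arc_digraph V A). diverging_tree T i \<and> j \<in> verts T"
    then obtain v where v: "v \<in> V" "j \<in> weak_class A v"
      and arb: "arborescence (weak_class A v) i (A \<inter> weak_class A v \<times> weak_class A v)"
      using iff by (auto simp: weak_components_arc_digraph[OF AV] weak_component_def)
    have "i \<notin> Range A"
      using arb weak_class_step by (fastforce simp: arborescence_def)
    moreover have "(i, j) \<in> A\<^sup>*"
      using arb v(2) rtrancl_mono[of "A \<inter> weak_class A v \<times> weak_class A v" A]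
      by (auto simp: arborescence_def)
    ultimately show "i \<notin> Range A \<and> (i, j) \<in> A\<^sup>*" by blast
  next
    assume i: "i \<notin> Range A \<and> (i, j) \<in> A\<^sup>*"
    have "j \<in> weak_class A i"
      using i by (simp add: branching_weak_class[OF A])
    then have "weak_class A j = weak_class A i"
      by (simp add: weak_class_eq)
    then have "diverging_tree (weak_component A j) i"
      using branching_weak_component[OF A] i iff[OF \<open>j \<in> V\<close>] by auto
    then show "\<exists>T\<in>weak_components (arc_digraph V A). diverging_tree T i \<and> j \<in> verts T"
      using \<open>j \<in> V\<close> by (auto simp: weak_components_arc_digraph[OF AV] weak_component_def)
  qed
qed

text \<open>Each component contains exactly one root, since a root is reachable from no other
  root.\<close>

lemma card_weak_components:
  assumes fin: "finite V" and AV: "A \<subseteq> V \<times> V" and A: "branching A"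
  shows "card (weak_components (arc_digraph V A)) = card (V - Range A)"
proof -
  have finA: "finite A" using fin AV by (meson finite_SigmaI finite_subset)
  have "weak_component A ` V = weak_component A ` (V - Range A)"
  proof (intro subset_antisym image_subsetI)
    fix v assume "v \<in> V"
    obtain r where r: "r \<notin> Range A" "(r, v) \<in> A\<^sup>*"
      using branching_root_exists[OF A finA] by blast
    then have v: "v \<in> weak_class A r"
      by (simp add: branching_weak_class[OF A])
    then have "weak_component A v = weak_component A r"
      by (simp add: weak_component_def weak_class_eq)
    moreover have "r \<in> V"
      using r(2) \<open>v \<in> V\<close> AV by (metis SigmaD1 converse_rtranclE subsetD)
    ultimately show "weak_component A v \<in> weak_component A ` (V - Range A)"
      using r(1) by auto
  qed auto
  moreover have "inj_on (weak_component A) (V - Range A)"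
  proof (rule inj_onI)
    fix r r' assume r: "r \<in> V - Range A" "r' \<in> V - Range A"
      and "weak_component A r = weak_component A r'"
    then have "weak_class A r = weak_class A r'" by (simp add: weak_component_def)
    then have "(r, r') \<in> A\<^sup>*"
      using branching_weak_class[OF A, of r] r weak_class_refl by auto
    then show "r = r'"
      using r by (metis DiffD2 Range.intros rtranclE)
  qed
  ultimately show ?thesis
    by (simp add: weak_components_arc_digraph[OF AV] card_image)
qed

lemma card_single_valued_converse:
  assumes "single_valued (A\<inverse>)"
  shows "card A = card (Range A)"
proof -
  have "inj_on snd A"
    using assms by (auto simp: inj_on_def single_valued_def)
  then show ?thesis
    by (metis Range_snd card_image)
qed

section \<open>Source knots and maximum out-forests\<close>

text \<open>A strong component that no arc enters is the full set of predecessors of any of its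
  vertices \<open>v\<close>, and \<open>v\<close> reaches all of them back. This form makes closure
  under predecessors immediate.\<close>

definition knots :: "'a rel \<Rightarrow> 'a set set" where
  "knots E = {{u. (u, v) \<in> E\<^sup>*} | v. \<forall>u. (u, v) \<in> E\<^sup>* \<longrightarrow> (v, u) \<in> E\<^sup>*}"

text \<open>The maximality of the number of arcs is expressed by the position of the roots: all of
  them in knots, at most one in each knot.\<close>

definition max_branchings :: "'a rel \<Rightarrow> 'a rel set" where
  "max_branchings E = {A. A \<subseteq> E \<and> branching A \<and> - Range A \<subseteq> \<Union>(knots E)
     \<and> (\<forall>K\<in>knots E. \<forall>r\<in>K - Range A. \<forall>r'\<in>K - Range A. r = r')}"

lemma source_knots_arc_digraph: "source_knots (arc_digraph UNIV E) = knots E"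
proof -
  let ?G = "arc_digraph UNIV E"
  interpret wf_digraph ?G by simp
  have reach: "u \<rightarrow>\<^sup>*\<^bsub>?G\<^esub> v \<longleftrightarrow> (u, v) \<in> E\<^sup>*" for u v
    by (simp add: reachable_conv)
  have "S \<in> source_knots ?G \<longleftrightarrow> S \<in> sccs_verts \<and> (\<forall>u v. (u, v) \<in> E \<longrightarrow> v \<in> S \<longrightarrow> u \<in> S)" for S
    unfolding source_knots_def sccs_verts_conv by auto
  moreover have "S \<in> sccs_verts \<and> (\<forall>u v. (u, v) \<in> E \<longrightarrow> v \<in> S \<longrightarrow> u \<in> S) \<longleftrightarrow> S \<in> knots E" for S
  proof
    assume S: "S \<in> sccs_verts \<and> (\<forall>u v. (u, v) \<in> E \<longrightarrow> v \<in> S \<longrightarrow> u \<in> S)"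
    then obtain v where v: "v \<in> S" by (auto simp: sccs_verts_def)
    have "u \<in> S" if "(u, v) \<in> E\<^sup>*" for u
      using that by (induction rule: converse_rtrancl_induct) (use S v in auto)
    moreover have "(u, v) \<in> E\<^sup>* \<and> (v, u) \<in> E\<^sup>*" if "u \<in> S" for u
      using S v that by (auto simp: in_sccs_verts_conv_reachable reach)
    ultimately have "S = {u. (u, v) \<in> E\<^sup>*}" "\<forall>u. (u, v) \<in> E\<^sup>* \<longrightarrow> (v, u) \<in> E\<^sup>*" by blast+
    then show "S \<in> knots E" unfolding knots_def by blast
  next
    assume "S \<in> knots E"
    then obtain v where v: "S = {u. (u, v) \<in> E\<^sup>*}" "\<And>u. (u, v) \<in> E\<^sup>* \<Longrightarrow> (v, u) \<in> E\<^sup>*"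
      unfolding knots_def by blast
    have "v \<in> S" using v by simp
    moreover have "\<forall>u\<in>S. \<forall>u'\<in>S. (u, u') \<in> E\<^sup>*"
      using v by (auto intro: rtrancl_trans)
    moreover have "(u', u) \<notin> E\<^sup>*" if "u \<in> S" "u' \<notin> S" for u u'
      using v that by (auto intro: rtrancl_trans)
    moreover have "\<forall>u v. (u, v) \<in> E \<longrightarrow> v \<in> S \<longrightarrow> u \<in> S"
      using v(1) by (auto intro: converse_rtrancl_into_rtrancl)
    ultimately show "S \<in> sccs_verts \<and> (\<forall>u v. (u, v) \<in> E \<longrightarrow> v \<in> S \<longrightarrow> u \<in> S)"
      unfolding in_sccs_verts_conv_reachable reach by blast
  qed
  ultimately show ?thesis by blast
qed

lemma knot_nonempty: "K \<in> knots E \<Longrightarrow> K \<noteq> {}"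
  unfolding knots_def by auto

lemma knot_pred_closed: "K \<in> knots E \<Longrightarrow> (u, v) \<in> E \<Longrightarrow> v \<in> K \<Longrightarrow> u \<in> K"
  unfolding knots_def by (auto intro: converse_rtrancl_into_rtrancl)

lemma knot_pred_closed_rtrancl: "(u, v) \<in> E\<^sup>* \<Longrightarrow> K \<in> knots E \<Longrightarrow> v \<in> K \<Longrightarrow> u \<in> K"
  by (induction rule: converse_rtrancl_induct) (auto intro: knot_pred_closed)

lemma knot_connected: "K \<in> knots E \<Longrightarrow> u \<in> K \<Longrightarrow> v \<in> K \<Longrightarrow> (u, v) \<in> E\<^sup>*"
  unfolding knots_def by (auto intro: rtrancl_trans)

lemma knot_eqI: "K \<in> knots E \<Longrightarrow> K' \<in> knots E \<Longrightarrow> v \<in> K \<Longrightarrow> v \<in> K' \<Longrightarrow> K = K'"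
  by (blast intro: knot_pred_closed_rtrancl knot_connected)

text \<open>Among the vertices that reach \<open>v\<close>, take \<open>u\<close> with the fewest
  predecessors. Any predecessor of \<open>u\<close> has no more predecessors than \<open>u\<close>
  and no fewer, hence the same ones, and \<open>u\<close> is among them.\<close>

lemma reachable_from_knot:
  fixes E :: "('a::finite) rel"
  obtains K u where "K \<in> knots E" "u \<in> K" "(u, v) \<in> E\<^sup>*"
proof -
  obtain u where u: "(u, v) \<in> E\<^sup>*"
    and min: "\<And>x. (x, v) \<in> E\<^sup>* \<Longrightarrow> card {y. (y, u) \<in> E\<^sup>*} \<le> card {y. (y, x) \<in> E\<^sup>*}"
    using ex_has_least_nat[of "\<lambda>u. (u, v) \<in> E\<^sup>*" v "\<lambda>u. card {y. (y, u) \<in> E\<^sup>*}"] by blast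
  have "(u, x) \<in> E\<^sup>*" if x: "(x, u) \<in> E\<^sup>*" for x
  proof -
    have "{y. (y, x) \<in> E\<^sup>*} \<subseteq> {y. (y, u) \<in> E\<^sup>*}" using x by (auto intro: rtrancl_trans)
    moreover have "card {y. (y, u) \<in> E\<^sup>*} \<le> card {y. (y, x) \<in> E\<^sup>*}"
      using min x u by (meson rtrancl_trans)
    ultimately have "{y. (y, x) \<in> E\<^sup>*} = {y. (y, u) \<in> E\<^sup>*}"
      by (simp add: card_seteq)
    then show ?thesis by blast
  qed
  then have "{y. (y, u) \<in> E\<^sup>*} \<in> knots E" unfolding knots_def by blast
  then show ?thesis using that u by blast
qed

text \<open>A breadth-first forest: each vertex outside \<open>R\<close> chooses a predecessor
  strictly closer to \<open>R\<close>, so the distance \<open>d\<close> from \<open>R\<close> rules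
  out cycles.\<close>

lemma branching_with_roots:
  assumes reach: "\<And>v. \<exists>r\<in>R. (r, v) \<in> E\<^sup>*"
  obtains A where "A \<subseteq> E" "branching A" "- Range A = R"
proof -
  define d where "d v = (LEAST n. \<exists>r\<in>R. (r, v) \<in> E ^^ n)" for v
  have d: "\<exists>r\<in>R. (r, v) \<in> E ^^ d v" for v
  proof -
    obtain r n where "r \<in> R" "(r, v) \<in> E ^^ n"
      using reach[of v] by (auto simp: rtrancl_power)
    then have "\<exists>r\<in>R. (r, v) \<in> E ^^ n" by blast
    then show ?thesis unfolding d_def by (rule LeastI)
  qed
  have "\<exists>u. (u, v) \<in> E \<and> d u < d v" if "v \<notin> R" for v
  proof -
    obtain r where r: "r \<in> R" "(r, v) \<in> E ^^ d v" using d by blast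
    then have "d v \<noteq> 0" using that by (metis relpow_0_E)
    then obtain n where n: "d v = Suc n" using not0_implies_Suc by blast
    then obtain u where u: "(r, u) \<in> E ^^ n" "(u, v) \<in> E" using r(2) by auto
    then have "d u \<le> n" unfolding d_def using r(1) by (intro Least_le) blast
    then show ?thesis using u n by auto
  qed
  then obtain p where p: "\<And>v. v \<notin> R \<Longrightarrow> (p v, v) \<in> E \<and> d (p v) < d v" by metis
  define A where "A = {(p v, v) | v. v \<notin> R}"
  have "A \<subseteq> Wellfounded.measure d" using p by (auto simp: A_def)
  then have "acyclic A" by (meson acyclic_subset wf_acyclic wf_measure)
  moreover have "single_valued (A\<inverse>)" by (auto simp: A_def single_valued_def)
  ultimately show ?thesis
    using p by (intro that[of A]) (auto simp: A_def branching_def)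
qed

text \<open>The root above any vertex of the knot lies in the knot, which is closed under
  predecessors.\<close>

lemma knot_contains_root:
  assumes "branching A" "finite A" "A \<subseteq> E" "K \<in> knots E"
  shows "\<exists>r\<in>K. r \<notin> Range A"
proof -
  obtain v where v: "v \<in> K" using knot_nonempty assms(4) by blast
  obtain r where r: "r \<notin> Range A" "(r, v) \<in> A\<^sup>*"
    using branching_root_exists assms(1,2) by metis
  then have "(r, v) \<in> E\<^sup>*" using rtrancl_mono[OF assms(3)] by blast
  then show ?thesis using r(1) v assms(4) knot_pred_closed_rtrancl by metis
qed

text \<open>Choose a root \<open>\<rho> K\<close> in each knot. As knots are disjoint,
  \<open>\<rho>\<close> is injective, which gives the inequality. Equality of the cardinalities
  means that \<open>\<rho>\<close> exhausts the roots.\<close>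

lemma card_roots_knots:
  fixes E :: "('a::finite) rel"
  assumes A: "branching A" "A \<subseteq> E"
  shows "card (knots E) \<le> card (- Range A)"
    and "card (- Range A) = card (knots E) \<longleftrightarrow> A \<in> max_branchings E"
proof -
  obtain \<rho> where \<rho>: "\<And>K. K \<in> knots E \<Longrightarrow> \<rho> K \<in> K \<and> \<rho> K \<notin> Range A"
    using knot_contains_root[OF A(1) _ A(2)] by (metis finite)
  have inj: "inj_on \<rho> (knots E)"
    using \<rho> knot_eqI by (metis inj_onI)
  have sub: "\<rho> ` knots E \<subseteq> - Range A" using \<rho> by auto
  show "card (knots E) \<le> card (- Range A)"
    using card_mono[OF _ sub] card_image[OF inj] by simp
  have "card (- Range A) = card (knots E) \<longleftrightarrow> - Range A = \<rho> ` knots E"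
  proof
    assume "card (- Range A) = card (knots E)"
    then show "- Range A = \<rho> ` knots E"
      using card_subset_eq[OF _ sub] card_image[OF inj] by simp
  qed (simp add: card_image[OF inj])
  also have "\<dots> \<longleftrightarrow> A \<in> max_branchings E"
  proof
    assume roots: "- Range A = \<rho> ` knots E"
    have "r = \<rho> K" if "K \<in> knots E" "r \<in> K" "r \<notin> Range A" for K r
      using that roots \<rho> knot_eqI by (metis ComplI imageE)
    moreover have "- Range A \<subseteq> \<Union>(knots E)" using roots \<rho> by auto
    ultimately show "A \<in> max_branchings E"
      using A unfolding max_branchings_def by blast
  next
    assume "A \<in> max_branchings E"
    then have K: "- Range A \<subseteq> \<Union>(knots E)"
      "\<And>K r r'. K \<in> knots E \<Longrightarrow> r \<in> K - Range A \<Longrightarrow> r' \<in> K - Range A \<Longrightarrow> r = r'"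
      by (simp_all add: max_branchings_def)
    have "r \<in> \<rho> ` knots E" if "r \<notin> Range A" for r
    proof -
      obtain K where "K \<in> knots E" "r \<in> K" using \<open>r \<notin> Range A\<close> K(1) by blast
      then have "r = \<rho> K" using K(2) \<rho> that by blast
      then show ?thesis using \<open>K \<in> knots E\<close> by blast
    qed
    then show "- Range A = \<rho> ` knots E"
      using sub by blast
  qed
  finally show "card (- Range A) = card (knots E) \<longleftrightarrow> A \<in> max_branchings E" .
qed

text \<open>Prescribe \<open>i\<close> in \<open>K\<close> and an arbitrary vertex in every other
  knot. The prescribed vertices reach everything, so a branching with exactly these roots exists,
  and it has one root per knot.\<close>

lemma max_branching_with_root:
  fixes E :: "('a::finite) rel"
  assumes "K \<in> knots E" "i \<in> K"
  obtains A where "A \<in> max_branchings E" "i \<notin> Range A"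
proof -
  define \<rho> where "\<rho> = (\<lambda>K'. if K' = K then i else (SOME r. r \<in> K'))"
  have \<rho>: "\<rho> K' \<in> K'" if "K' \<in> knots E" for K'
    using knot_nonempty[OF that] assms(2) by (auto simp: \<rho>_def intro: some_in_eq[THEN iffD2])
  have "\<exists>r\<in>\<rho> ` knots E. (r, v) \<in> E\<^sup>*" for v
  proof -
    obtain K' u where "K' \<in> knots E" "u \<in> K'" "(u, v) \<in> E\<^sup>*" by (rule reachable_from_knot)
    then show ?thesis using \<rho> knot_connected by (metis imageI rtrancl_trans)
  qed
  then obtain A where A: "A \<subseteq> E" "branching A" "- Range A = \<rho> ` knots E"
    using branching_with_roots by metis
  have "inj_on \<rho> (knots E)" using \<rho> knot_eqI by (metis inj_onI)
  then have "card (- Range A) = card (knots E)" by (simp add: A(3) card_image)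
  then have "A \<in> max_branchings E" using card_roots_knots(2)[OF A(2,1)] by simp
  moreover have "i \<in> - Range A" using A(3) assms(1) by (auto simp: \<rho>_def)
  ultimately show ?thesis using that by blast
qed

lemma max_branchings_nonempty:
  fixes E :: "('a::finite) rel"
  shows "max_branchings E \<noteq> {}"
proof -
  obtain K u where "K \<in> knots E" "u \<in> K" using reachable_from_knot by metis
  then show ?thesis using max_branching_with_root by blast
qed

section \<open>Sets of out-forests as sets of branchings\<close>

lemma out_forests_arc_digraph:
  fixes E :: "('a::finite) rel"
  shows "out_forests (arc_digraph UNIV E) = arc_digraph UNIV ` {A. A \<subseteq> E \<and> branching A}"
proof -
  have branching: "(\<forall>T\<in>weak_components (arc_digraph UNIV A). \<exists>r. diverging_tree T r) \<longleftrightarrow> branching A"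
    for A :: "'a rel"
    by (rule weak_components_diverging_iff_branching) simp_all
  have "spanning F (arc_digraph UNIV E) \<longleftrightarrow> (\<exists>A\<subseteq>E. F = arc_digraph UNIV A)" for F
    by (rule spanning_arc_digraph_iff) simp
  then have "{F. spanning F (arc_digraph UNIV E) \<and> P F}
      = arc_digraph UNIV ` {A. A \<subseteq> E \<and> P (arc_digraph UNIV A)}" for P
    by auto
  then show ?thesis
    unfolding out_forests_def by (simp add: branching)
qed

lemma out_forest_dim_arc_digraph:
  fixes E :: "('a::finite) rel"
  shows "out_forest_dim (arc_digraph UNIV E) = card (knots E)"
proof -
  have card: "card (weak_components (arc_digraph UNIV A)) = card (- Range A)" if "branching A"
    for A :: "'a rel"
    using that by (simp add: card_weak_components Compl_eq_Diff_UNIV)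
  obtain A where "A \<in> max_branchings E" using max_branchings_nonempty by blast
  then have A: "A \<subseteq> E" "branching A" by (auto simp: max_branchings_def)
  have "card (- Range A) = card (knots E)"
    using card_roots_knots(2)[OF A(2,1)] \<open>A \<in> max_branchings E\<close> by simp
  then show ?thesis
    unfolding out_forest_dim_def out_forests_arc_digraph
    using A card card_roots_knots(1) by (intro Least_equality) auto
qed

text \<open>Every vertex other than a root has exactly one entering arc, so arcs and roots together
  number \<open>n\<close>. Having \<open>n - d'\<close> arcs thus means having as many roots as
  there are knots.\<close>

lemma max_out_forests_arc_digraph:
  fixes E :: "('a::finite) rel"
  shows "max_out_forests (arc_digraph UNIV E) = arc_digraph UNIV ` max_branchings E"
proof -
  have "card A = CARD('a) - card (knots E) \<longleftrightarrow> A \<in> max_branchings E"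
    if A: "A \<subseteq> E" "branching A" for A :: "'a rel"
  proof -
    have "card A = CARD('a) - card (- Range A)"
      using A(2) card_single_valued_converse[of A] card_Un_disjoint[of "Range A" "- Range A"]
      by (simp add: branching_def Compl_partition)
    moreover have "card (- Range A) \<le> CARD('a)" by (simp add: card_mono)
    ultimately show ?thesis
      using card_roots_knots[OF A(2,1)] by linarith
  qed
  then show ?thesis
    unfolding max_out_forests_def out_forests_arc_digraph out_forest_dim_arc_digraph
    by (auto simp: max_branchings_def)
qed

lemma max_out_forests_from_to_arc_digraph:
  fixes E :: "('a::finite) rel"
  shows "max_out_forests_from_to (arc_digraph UNIV E) i j
    = arc_digraph UNIV ` {A \<in> max_branchings E. i \<notin> Range A \<and> (i, j) \<in> A\<^sup>*}"
proof -
  have "(\<exists>T\<in>weak_components (arc_digraph UNIV A). diverging_tree T i \<and> j \<in> verts T)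
      \<longleftrightarrow> i \<notin> Range A \<and> (i, j) \<in> A\<^sup>*" if "A \<in> max_branchings E" for A
    using that by (intro weak_component_root_iff) (simp_all add: max_branchings_def)
  then show ?thesis
    unfolding max_out_forests_from_to_def max_out_forests_arc_digraph by blast
qed

section \<open>Exchanging trees on a source knot\<close>

definition arc_weight :: "('a \<Rightarrow> 'a \<Rightarrow> real) \<Rightarrow> 'a rel \<Rightarrow> real" where
  "arc_weight w A = (\<Prod>(i, j)\<in>A. w i j)"

definition arborescences :: "'a rel \<Rightarrow> 'a set \<Rightarrow> 'a \<Rightarrow> 'a rel set" where
  "arborescences E K i = {T. T \<subseteq> E \<and> arborescence K i T}"

text \<open>What remains of a maximum branching after its tree on \<open>K\<close> is removed.
  Whether \<open>j\<close> is reachable from \<open>K\<close> depends only on this remainder, by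
  \<open>rtrancl_last_exit\<close>.\<close>

definition rest_branchings :: "'a rel \<Rightarrow> 'a set \<Rightarrow> 'a \<Rightarrow> 'a rel set" where
  "rest_branchings E K j = {A - K \<times> K | A. A \<in> max_branchings E \<and> j \<in> A\<^sup>* `` K}"

lemma max_branchingsD:
  assumes "A \<in> max_branchings E"
  shows "A \<subseteq> E" "branching A" "- Range A \<subseteq> \<Union>(knots E)"
    "\<And>K r r'. K \<in> knots E \<Longrightarrow> r \<in> K \<Longrightarrow> r \<notin> Range A \<Longrightarrow> r' \<in> K \<Longrightarrow> r' \<notin> Range A \<Longrightarrow> r = r'"
  using assms by (simp_all add: max_branchings_def)

lemma max_branchingsI:
  assumes "A \<subseteq> E" "single_valued (A\<inverse>)" "acyclic A" "- Range A \<subseteq> \<Union>(knots E)"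
    "\<And>K r r'. K \<in> knots E \<Longrightarrow> r \<in> K - Range A \<Longrightarrow> r' \<in> K - Range A \<Longrightarrow> r = r'"
  shows "A \<in> max_branchings E"
  unfolding max_branchings_def branching_def using assms by simp

lemma arborescencesD:
  assumes "T \<in> arborescences E K i"
  shows "T \<subseteq> E \<inter> K \<times> K" "single_valued (T\<inverse>)" "i \<in> K" "i \<notin> Range T"
    "\<And>v. v \<in> K \<Longrightarrow> (i, v) \<in> T\<^sup>*" "acyclic T"
proof -
  have "arborescence K i T" "T \<subseteq> E" using assms by (simp_all add: arborescences_def)
  then show "T \<subseteq> E \<inter> K \<times> K" "single_valued (T\<inverse>)" "i \<in> K" "i \<notin> Range T"
    "\<And>v. v \<in> K \<Longrightarrow> (i, v) \<in> T\<^sup>*" "acyclic T"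
    using arborescence_acyclic[of K i T] by (simp_all add: arborescence_def)
qed

lemma arc_weight_insert:
  fixes A :: "('a::finite) rel"
  shows "(i, j) \<notin> A \<Longrightarrow> arc_weight w (insert (i, j) A) = w i j * arc_weight w A"
  by (simp add: arc_weight_def)

lemma arc_weight_Un:
  fixes A B :: "('a::finite) rel"
  shows "A \<inter> B = {} \<Longrightarrow> arc_weight w (A \<union> B) = arc_weight w A * arc_weight w B"
  by (simp add: arc_weight_def prod.union_disjoint)

text \<open>A path to \<open>m\<close> can be cut at its first visit to \<open>m\<close>.\<close>

lemma rtrancl_avoid_out: "(a, m) \<in> R\<^sup>* \<Longrightarrow> (a, m) \<in> (R - {m} \<times> UNIV)\<^sup>*"
proof (induction rule: converse_rtrancl_induct)
  case (step y z)
  then show ?case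
    by (cases "y = m") (auto intro: converse_rtrancl_into_rtrancl)
qed simp

text \<open>A path from \<open>m\<close> can be started at its last visit to
  \<open>m\<close>.\<close>

lemma rtrancl_avoid_in: "(m, a) \<in> R\<^sup>* \<Longrightarrow> (m, a) \<in> (R - UNIV \<times> {m})\<^sup>*"
proof (induction rule: rtrancl_induct)
  case (step y z)
  then show ?case
    by (cases "z = m") (auto intro: rtrancl_into_rtrancl)
qed simp

text \<open>After its last vertex in \<open>K\<close>, a path uses no arc inside
  \<open>K\<close>.\<close>

lemma rtrancl_last_exit: "j \<in> A\<^sup>* `` K \<longleftrightarrow> j \<in> (A - K \<times> K)\<^sup>* `` K"
proof
  assume "j \<in> A\<^sup>* `` K"
  then obtain k where "k \<in> K" "(k, j) \<in> A\<^sup>*" by blast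
  from this(2,1) show "j \<in> (A - K \<times> K)\<^sup>* `` K"
  proof (induction rule: rtrancl_induct)
    case (step y z)
    then obtain k' where k': "k' \<in> K" "(k', y) \<in> (A - K \<times> K)\<^sup>*" by blast
    show ?case
    proof (cases "z \<in> K")
      case False
      then have "(k', z) \<in> (A - K \<times> K)\<^sup>*"
        using k'(2) step.hyps(2) by (auto intro: rtrancl_into_rtrancl)
      then show ?thesis using k'(1) by blast
    qed blast
  qed blast
next
  assume "j \<in> (A - K \<times> K)\<^sup>* `` K"
  moreover have "(A - K \<times> K)\<^sup>* \<subseteq> A\<^sup>*" by (rule rtrancl_mono) blast
  ultimately show "j \<in> A\<^sup>* `` K" by blast
qed

text \<open>All ancestors of a vertex of \<open>K\<close> lie in \<open>K\<close>. The path from its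
  root therefore runs inside \<open>K\<close>, and this root can only be \<open>i\<close>.\<close>

lemma max_branching_restrict:
  fixes E :: "('a::finite) rel"
  assumes A: "A \<in> max_branchings E" and K: "K \<in> knots E" and i: "i \<in> K" "i \<notin> Range A"
  shows "A \<inter> K \<times> K \<in> arborescences E K i"
proof -
  note A' = max_branchingsD[OF A]
  have uniq: "\<And>r. r \<in> K \<Longrightarrow> r \<notin> Range A \<Longrightarrow> r = i"
    using A'(4) K i by blast
  have "(i, v) \<in> (A \<inter> K \<times> K)\<^sup>*" if v: "v \<in> K" for v
  proof -
    obtain r where r: "r \<notin> Range A" "(r, v) \<in> A\<^sup>*"
      using branching_root_exists[OF A'(2)] by (metis finite)
    have closed: "u \<in> K" if "(u, u') \<in> A\<^sup>*" "u' \<in> K" for u u'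
      using knot_pred_closed_rtrancl[OF _ K] that rtrancl_mono[OF A'(1)] by blast
    have "r = i" using uniq r closed v by blast
    from r(2) v show ?thesis unfolding \<open>r = i\<close>
    proof (induction rule: rtrancl_induct)
      case (step y z)
      have "y \<in> K" using closed step.hyps(2) step.prems by blast
      then show ?case using step by (meson IntI SigmaI rtrancl.rtrancl_into_rtrancl)
    qed simp
  qed
  moreover have "single_valued ((A \<inter> K \<times> K)\<inverse>)"
    using A'(2) by (auto simp: branching_def single_valued_def)
  ultimately show ?thesis
    using A'(1) i by (auto simp: arborescences_def arborescence_def)
qed

text \<open>No arc enters \<open>K\<close> from outside, so the arcs of \<open>T\<close> and the
  remaining arcs have disjoint sets of heads and no cycle can mix them. Outside \<open>K\<close> the
  roots stay as they were; inside, \<open>i\<close> is the only one.\<close>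

lemma max_branching_exchange:
  fixes E :: "('a::finite) rel"
  assumes A: "A \<in> max_branchings E" and K: "K \<in> knots E" and T: "T \<in> arborescences E K i"
  shows "T \<union> (A - K \<times> K) \<in> max_branchings E" and "i \<notin> Range (T \<union> (A - K \<times> K))"
proof -
  let ?B = "A - K \<times> K"
  have A': "A \<subseteq> E" "single_valued (A\<inverse>)" "acyclic A"
    using A by (auto simp: max_branchings_def branching_def)
  have T': "T \<subseteq> E" "T \<subseteq> K \<times> K" "single_valued (T\<inverse>)" "i \<in> K" "i \<notin> Range T"
    and reach: "\<And>v. v \<in> K \<Longrightarrow> (i, v) \<in> T\<^sup>*" and "acyclic T"
    using arborescencesD[OF T] by blast+
  \<comment> \<open>An arc with head in \<open>K\<close> also has its tail in \<open>K\<close>, so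
    it has been removed.\<close>
  have B_head: "v \<notin> K" if "(u, v) \<in> ?B" for u v
    using that knot_pred_closed[OF K] A'(1) by blast
  have range_K: "v \<in> Range (T \<union> ?B) \<longleftrightarrow> v \<noteq> i" if "v \<in> K" for v
  proof
    assume "v \<noteq> i"
    then have "v \<in> Range T" using reach[OF that] by (metis Range.intros rtranclE)
    then show "v \<in> Range (T \<union> ?B)" by blast
  qed (use that T'(5) B_head in blast)
  have range_out: "v \<in> Range (T \<union> ?B) \<longleftrightarrow> v \<in> Range A" if "v \<notin> K" for v
    using that T'(2) by blast
  show "i \<notin> Range (T \<union> ?B)" using range_K T'(4) by blast
  have "single_valued ((T \<union> ?B)\<inverse>)"
    unfolding single_valued_def converse_iff
    using T'(2,3) A'(2) B_head by (blast dest: single_valued_converseD)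
  moreover have "acyclic (T \<union> ?B)"
  proof (rule acyclicI, intro allI notI)
    fix v assume cyc: "(v, v) \<in> (T \<union> ?B)\<^sup>+"
    \<comment> \<open>A path that ends in \<open>K\<close> can only use arcs of
      \<open>T\<close>.\<close>
    have into_K: "(u, v) \<in> T\<^sup>+ \<and> u \<in> K" if "(u, v) \<in> (T \<union> ?B)\<^sup>+" "v \<in> K" for u v
      using that
    proof (induction rule: converse_trancl_induct)
      case (base y)
      then show ?case using B_head T'(2) by blast
    next
      case (step y z)
      then have "(y, z) \<in> T" using B_head by blast
      then show ?case using step T'(2) by (meson SigmaD1 subsetD trancl_into_trancl2)
    qed
    \<comment> \<open>A path that starts outside \<open>K\<close> never enters \<open>K\<close>, so
      it only uses arcs of \<open>A\<close>.\<close>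
    have out_K: "(u, v) \<in> A\<^sup>+ \<and> v \<notin> K" if "(u, v) \<in> (T \<union> ?B)\<^sup>+" "u \<notin> K" for u v
      using that
    proof (induction rule: trancl_induct)
      case (base y)
      then show ?case using B_head T'(2) by blast
    next
      case (step y z)
      then have "(y, z) \<in> ?B" using T'(2) by blast
      then show ?case using step B_head by (meson DiffD1 trancl.trancl_into_trancl)
    qed
    show False
      using into_K[OF cyc] out_K[OF cyc] A'(3) \<open>acyclic T\<close> unfolding acyclic_def by blast
  qed
  moreover have "- Range (T \<union> ?B) \<subseteq> \<Union>(knots E)"
  proof
    fix v assume v: "v \<in> - Range (T \<union> ?B)"
    show "v \<in> \<Union>(knots E)"
      using v range_out[of v] K max_branchingsD(3)[OF A] by (cases "v \<in> K") blast+
  qed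
  moreover have "r = r'"
    if "K' \<in> knots E" "r \<in> K' - Range (T \<union> ?B)" "r' \<in> K' - Range (T \<union> ?B)" for K' r r'
  proof (cases "K' = K")
    case True
    then show ?thesis using that range_K by blast
  next
    case False
    then have "r \<notin> K" "r' \<notin> K" using that knot_eqI[OF K] by blast+
    then have "r \<in> K' - Range A" "r' \<in> K' - Range A" using that range_out by blast+
    then show ?thesis using max_branchingsD(4)[OF A that(1)] by blast
  qed
  moreover have "T \<union> ?B \<subseteq> E" using A'(1) T'(1) by blast
  ultimately show "T \<union> ?B \<in> max_branchings E" by (intro max_branchingsI)
qed

text \<open>Splitting \<open>A\<close> into \<open>A \<inter> K \<times> K\<close> and
  \<open>A - K \<times> K\<close> is a bijection onto pairs of a tree rooted at \<open>i\<close> and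
  a remainder, because trees can be exchanged freely. The second factor does not involve
  \<open>i\<close>.\<close>

lemma sum_max_branchings_decompose:
  fixes E :: "('a::finite) rel"
  assumes K: "K \<in> knots E" and i: "i \<in> K"
  shows "(\<Sum>A\<in>{A \<in> max_branchings E. i \<notin> Range A \<and> (i, j) \<in> A\<^sup>*}. arc_weight w A)
    = (\<Sum>T\<in>arborescences E K i. arc_weight w T) * (\<Sum>B\<in>rest_branchings E K j. arc_weight w B)"
proof -
  let ?S = "arborescences E K i \<times> rest_branchings E K j"
  have T: "T \<subseteq> K \<times> K" "\<And>v. v \<in> K \<Longrightarrow> (i, v) \<in> T\<^sup>*" if "T \<in> arborescences E K i" for T
    using that by (auto simp: arborescences_def arborescence_def)
  have B: "B \<inter> K \<times> K = {}" if "B \<in> rest_branchings E K j" for B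
    using that by (auto simp: rest_branchings_def)
  have "bij_betw (\<lambda>(T, B). T \<union> B) ?S {A \<in> max_branchings E. i \<notin> Range A \<and> (i, j) \<in> A\<^sup>*}"
  proof (rule bij_betw_imageI)
    show "inj_on (\<lambda>(T, B). T \<union> B) ?S"
    proof (rule inj_onI, clarify)
      fix T B T' B'
      assume "T \<in> arborescences E K i" "T' \<in> arborescences E K i"
        and "B \<in> rest_branchings E K j" "B' \<in> rest_branchings E K j" and eq: "T \<union> B = T' \<union> B'"
      then have "T \<subseteq> K \<times> K" "T' \<subseteq> K \<times> K" "B \<inter> K \<times> K = {}" "B' \<inter> K \<times> K = {}"
        using T B by blast+
      then show "T = T' \<and> B = B'" using eq by blast
    qed
    show "(\<lambda>(T, B). T \<union> B) ` ?S = {A \<in> max_branchings E. i \<notin> Range A \<and> (i, j) \<in> A\<^sup>*}"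
    proof (intro subset_antisym subsetI)
      fix U assume "U \<in> (\<lambda>(T, B). T \<union> B) ` ?S"
      then obtain T A where U: "U = T \<union> (A - K \<times> K)" and T': "T \<in> arborescences E K i"
        and A: "A \<in> max_branchings E" "j \<in> A\<^sup>* `` K"
        by (auto simp: rest_branchings_def)
      have "j \<in> (A - K \<times> K)\<^sup>* `` K"
        using A(2) rtrancl_last_exit[of j A K] by blast
      then obtain k where "k \<in> K" "(k, j) \<in> (A - K \<times> K)\<^sup>*"
        by blast
      then have "(i, k) \<in> U\<^sup>*" "(k, j) \<in> U\<^sup>*"
        using T(2)[OF T'] unfolding U by (auto intro: in_rtrancl_UnI)
      then have "(i, j) \<in> U\<^sup>*" by (rule rtrancl_trans)
      then show "U \<in> {A \<in> max_branchings E. i \<notin> Range A \<and> (i, j) \<in> A\<^sup>*}"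
        using max_branching_exchange[OF A(1) K T'] unfolding U by blast
    next
      fix A assume A: "A \<in> {A \<in> max_branchings E. i \<notin> Range A \<and> (i, j) \<in> A\<^sup>*}"
      then have "A \<inter> K \<times> K \<in> arborescences E K i"
        using max_branching_restrict[OF _ K i] by blast
      moreover have "A - K \<times> K \<in> rest_branchings E K j"
        using A i unfolding rest_branchings_def by blast
      ultimately have "(A \<inter> K \<times> K, A - K \<times> K) \<in> ?S" by blast
      moreover have "A = (\<lambda>(T, B). T \<union> B) (A \<inter> K \<times> K, A - K \<times> K)" by auto
      ultimately show "A \<in> (\<lambda>(T, B). T \<union> B) ` ?S" by (rule rev_image_eqI)
    qed
  qed
  then have "(\<Sum>A\<in>{A \<in> max_branchings E. i \<notin> Range A \<and> (i, j) \<in> A\<^sup>*}. arc_weight w A)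
      = (\<Sum>p\<in>?S. arc_weight w ((\<lambda>(T, B). T \<union> B) p))"
    by (simp add: sum.reindex_bij_betw)
  also have "\<dots> = (\<Sum>(T, B)\<in>?S. arc_weight w T * arc_weight w B)"
  proof (rule sum.cong[OF refl], clarify)
    fix T B' assume "T \<in> arborescences E K i" "B' \<in> rest_branchings E K j"
    then have "T \<inter> B' = {}" using T B by blast
    then show "arc_weight w (T \<union> B') = arc_weight w T * arc_weight w B'"
      by (rule arc_weight_Un)
  qed
  finally show ?thesis
    by (simp only: sum_product sum.cartesian_product)
qed

section \<open>The Markov chain tree theorem\<close>

text \<open>Both sides sum the weights of the spanning subgraphs of \<open>K\<close> in which every vertex has
  exactly one entering arc and is reachable from \<open>m\<close>; such a subgraph has a single cycle, through
  \<open>m\<close>, and is cut open at the arc of the cycle that enters, respectively leaves, \<open>m\<close>.\<close>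
lemma markov_chain_tree:
  fixes E :: "('a::finite) rel"
  assumes m: "m \<in> K"
  shows "(\<Sum>k\<in>{k \<in> K. (k, m) \<in> E}. w k m) * (\<Sum>T\<in>arborescences E K m. arc_weight w T)
    = (\<Sum>j\<in>{j \<in> K. (m, j) \<in> E}. w m j * (\<Sum>T\<in>arborescences E K j. arc_weight w T))"
proof -
  \<comment> \<open>Reachability from \<open>m\<close> gives every other vertex of \<open>K\<close>
    an entering arc; \<open>m \<in> Range U\<close> supplies the one at \<open>m\<close>.\<close>
  define U where "U = {U. U \<subseteq> E \<inter> K \<times> K \<and> single_valued (U\<inverse>) \<and> m \<in> Range U
    \<and> (\<forall>v\<in>K. (m, v) \<in> U\<^sup>*)}"
  let ?I = "{k \<in> K. (k, m) \<in> E} \<times> arborescences E K m"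
  let ?O = "Sigma {j \<in> K. (m, j) \<in> E} (arborescences E K)"
  note arb = arborescencesD
  have insert_mono: "(a, b) \<in> (insert p T)\<^sup>*" if "(a, b) \<in> T\<^sup>*" for a b :: 'a and p T
    using that rtrancl_mono[of T "insert p T"] by blast
  have sv_insert: "single_valued ((insert (u, v) T)\<inverse>)"
    if "single_valued (T\<inverse>)" "v \<notin> Range T" for u v :: 'a and T
    using that by (auto simp: single_valued_def)
  have sv_diff: "single_valued ((T - {p})\<inverse>)"
    if "single_valued (T\<inverse>)" for T :: "'a rel" and p
    using that by (auto simp: single_valued_def)
  have bij_in: "bij_betw (\<lambda>(k, T). insert (k, m) T) ?I U"
  proof (rule bij_betw_imageI)
    show "inj_on (\<lambda>(k, T). insert (k, m) T) ?I"
    proof (rule inj_onI, clarify)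
      fix k T k' T'
      assume T: "T \<in> arborescences E K m" "T' \<in> arborescences E K m"
        and eq: "insert (k, m) T = insert (k', m) T'"
      have not_in: "(u, m) \<notin> T" "(u, m) \<notin> T'" for u
        using arb(4)[OF T(1)] arb(4)[OF T(2)] by blast+
      then have "k = k'" using eq by blast
      moreover have "T = T'" using eq not_in unfolding \<open>k = k'\<close> by (metis insert_ident)
      ultimately show "k = k' \<and> T = T'" by simp
    qed
    show "(\<lambda>(k, T). insert (k, m) T) ` ?I = U"
    proof (intro subset_antisym subsetI)
      fix V assume "V \<in> (\<lambda>(k, T). insert (k, m) T) ` ?I"
      then obtain k T where k: "k \<in> K" "(k, m) \<in> E" and T: "T \<in> arborescences E K m"
        and V: "V = insert (k, m) T" by auto
      have "V \<subseteq> E \<inter> K \<times> K" using arb(1)[OF T] k m V by blast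
      moreover have "single_valued (V\<inverse>)"
        unfolding V using arb(2,4)[OF T] by (rule sv_insert)
      moreover have "\<forall>v\<in>K. (m, v) \<in> V\<^sup>*"
        unfolding V by (intro ballI insert_mono arb(5)[OF T])
      moreover have "m \<in> Range V" using V by blast
      ultimately show "V \<in> U" unfolding U_def by simp
    next
      fix V assume "V \<in> U"
      then obtain k where V: "V \<subseteq> E \<inter> K \<times> K" "single_valued (V\<inverse>)" "\<And>v. v \<in> K \<Longrightarrow> (m, v) \<in> V\<^sup>*"
        and k: "(k, m) \<in> V"
        unfolding U_def by blast
      let ?T = "V - {(k, m)}"
      have "m \<notin> Range ?T" using V(2) k by (blast dest: single_valued_converseD)
      \<comment> \<open>Started at its last visit to \<open>m\<close>, the path uses no arc into
        \<open>m\<close>, in particular not the removed one.\<close>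
      moreover have "(m, v) \<in> ?T\<^sup>*" if "v \<in> K" for v
        using rtrancl_avoid_in[OF V(3)[OF that]] rtrancl_mono[of "V - UNIV \<times> {m}" ?T] by blast
      ultimately have "?T \<in> arborescences E K m"
        using V(1) m sv_diff[OF V(2)] unfolding arborescences_def arborescence_def by blast
      moreover have "V = insert (k, m) ?T" using k by blast
      moreover have "k \<in> K" "(k, m) \<in> E" using k V(1) by blast+
      ultimately show "V \<in> (\<lambda>(k, T). insert (k, m) T) ` ?I"
        by (intro image_eqI[of _ _ "(k, ?T)"]) simp_all
    qed
  qed
  have bij_out: "bij_betw (\<lambda>(j, T). insert (m, j) T) ?O U"
  proof (rule bij_betw_imageI)
    show "inj_on (\<lambda>(j, T). insert (m, j) T) ?O"
    proof (rule inj_onI, clarify)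
      fix j T j' T'
      assume T: "T \<in> arborescences E K j" "T' \<in> arborescences E K j'"
        and eq: "insert (m, j) T = insert (m, j') T'"
      \<comment> \<open>Otherwise the arc from \<open>m\<close> to \<open>j'\<close> belongs to
        \<open>T\<close>. The path of \<open>T'\<close> from \<open>j'\<close> to \<open>m\<close>,
        cut at its first visit to \<open>m\<close>, uses no arc out of \<open>m\<close> and so lies
        in \<open>T\<close> as well, closing a cycle there.\<close>
      have "j = j'"
      proof (rule ccontr)
        assume "j \<noteq> j'"
        moreover have "(m, j') \<in> insert (m, j) T" unfolding eq by simp
        ultimately have "(m, j') \<in> T" by simp
        have "T' \<subseteq> insert (m, j) T" unfolding eq by (rule subset_insertI)
        then have "T' - {m} \<times> UNIV \<subseteq> T" by blast
        then have "(T' - {m} \<times> UNIV)\<^sup>* \<subseteq> T\<^sup>*" by (rule rtrancl_mono)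
        then have "(j', m) \<in> T\<^sup>*"
          using rtrancl_avoid_out[OF arb(5)[OF T(2) m]] by blast
        then have "(m, m) \<in> T\<^sup>+" using \<open>(m, j') \<in> T\<close> by (rule rtrancl_into_trancl2[rotated])
        then show False using arb(6)[OF T(1)] by (simp add: acyclic_def)
      qed
      moreover have "(m, j) \<notin> T" "(m, j') \<notin> T'" using arb(4)[OF T(1)] arb(4)[OF T(2)] by blast+
      ultimately show "j = j' \<and> T = T'" using eq by (metis insert_ident)
    qed
    show "(\<lambda>(j, T). insert (m, j) T) ` ?O = U"
    proof (intro subset_antisym subsetI)
      fix V assume "V \<in> (\<lambda>(j, T). insert (m, j) T) ` ?O"
      then obtain j T where j: "j \<in> K" "(m, j) \<in> E" and T: "T \<in> arborescences E K j"
        and V: "V = insert (m, j) T" by auto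
      have "V \<subseteq> E \<inter> K \<times> K" using arb(1)[OF T] j m V by blast
      moreover have "single_valued (V\<inverse>)"
        unfolding V using arb(2,4)[OF T] by (rule sv_insert)
      moreover have "(m, v) \<in> V\<^sup>*" if "v \<in> K" for v
        using insert_mono[OF arb(5)[OF T that]] V by (blast intro: converse_rtrancl_into_rtrancl)
      \<comment> \<open>The entering arc is the last one on the path from \<open>j\<close> to
        \<open>m\<close>, or the added arc itself if \<open>j = m\<close>.\<close>
      moreover have "m \<in> Range V"
        using arb(5)[OF T m] V by (metis Range.intros insertI1 insertI2 rtranclE)
      ultimately show "V \<in> U" unfolding U_def by simp
    next
      fix V assume "V \<in> U"
      then obtain u where V: "V \<subseteq> E \<inter> K \<times> K" "single_valued (V\<inverse>)" "\<And>v. v \<in> K \<Longrightarrow> (m, v) \<in> V\<^sup>*"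
        and u: "(u, m) \<in> V"
        unfolding U_def by blast
      have "(m, u) \<in> V\<^sup>*" using V(1,3) u by blast
      then have "(m, m) \<in> V\<^sup>+" using u by (rule rtrancl_into_trancl1)
      \<comment> \<open>The successor of \<open>m\<close> on the cycle becomes the root once the arc
        leading to it is removed.\<close>
      then obtain j where j: "(m, j) \<in> V" "(j, m) \<in> V\<^sup>*" by (meson tranclD)
      let ?T = "V - {(m, j)}"
      have jm: "(j, m) \<in> ?T\<^sup>*"
        using rtrancl_avoid_out[OF j(2)] rtrancl_mono[of "V - {m} \<times> UNIV" ?T] by blast
      \<comment> \<open>Follow a path from \<open>m\<close> to \<open>v\<close>, reaching
        \<open>m\<close> from \<open>j\<close> first. Wherever it uses the removed arc it arrives at
        \<open>j\<close>, and the path is begun anew there.\<close>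
      have "(j, v) \<in> ?T\<^sup>*" if "v \<in> K" for v
        using V(3)[OF that]
      proof (induction rule: rtrancl_induct)
        case (step y z)
        then show ?case
          by (cases "(y, z) = (m, j)") (auto intro: rtrancl_into_rtrancl)
      qed (rule jm)
      moreover have "j \<notin> Range ?T" using V(2) j(1) by (blast dest: single_valued_converseD)
      moreover have "j \<in> K" "(m, j) \<in> E" using j(1) V(1) by blast+
      ultimately have "?T \<in> arborescences E K j"
        using V(1) sv_diff[OF V(2)] unfolding arborescences_def arborescence_def by blast
      moreover have "V = insert (m, j) ?T" using j(1) by blast
      ultimately show "V \<in> (\<lambda>(j, T). insert (m, j) T) ` ?O"
        using \<open>j \<in> K\<close> \<open>(m, j) \<in> E\<close> by (intro image_eqI[of _ _ "(j, ?T)"]) simp_all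
    qed
  qed
  have "(\<Sum>k\<in>{k \<in> K. (k, m) \<in> E}. w k m) * (\<Sum>T\<in>arborescences E K m. arc_weight w T)
      = (\<Sum>(k, T)\<in>?I. w k m * arc_weight w T)"
    by (simp only: sum_product sum.cartesian_product)
  also have "\<dots> = (\<Sum>p\<in>?I. arc_weight w ((\<lambda>(k, T). insert (k, m) T) p))"
  proof (rule sum.cong[OF refl], clarify)
    fix k T assume "T \<in> arborescences E K m"
    then have "(k, m) \<notin> T" using arb(4) by fast
    then show "w k m * arc_weight w T = arc_weight w (insert (k, m) T)"
      by (simp add: arc_weight_insert)
  qed
  also have "\<dots> = (\<Sum>V\<in>U. arc_weight w V)"
    by (rule sum.reindex_bij_betw[OF bij_in])
  also have "\<dots> = (\<Sum>p\<in>?O. arc_weight w ((\<lambda>(j, T). insert (m, j) T) p))"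
    by (rule sum.reindex_bij_betw[OF bij_out, symmetric])
  also have "\<dots> = (\<Sum>(j, T)\<in>?O. w m j * arc_weight w T)"
  proof (rule sum.cong[OF refl], clarify)
    fix j T assume "T \<in> arborescences E K j"
    then have "(m, j) \<notin> T" using arb(4) by fast
    then show "arc_weight w (insert (m, j) T) = w m j * arc_weight w T"
      by (simp add: arc_weight_insert)
  qed
  also have "\<dots> = (\<Sum>j\<in>{j \<in> K. (m, j) \<in> E}. w m j * (\<Sum>T\<in>arborescences E K j. arc_weight w T))"
    by (simp add: sum_distrib_left sum.Sigma)
  finally show ?thesis .
qed

section \<open>The kernel of the Laplacian\<close>

text \<open>These are the rows of \<open>Lx = 0\<close> with the off-diagonal terms moved to the
  right: the balance equations of a Markov chain, with all coefficients nonnegative.\<close>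

definition harmonic :: "('a \<Rightarrow> 'a \<Rightarrow> real) \<Rightarrow> ('a::finite \<Rightarrow> real) \<Rightarrow> bool" where
  "harmonic w x \<longleftrightarrow> (\<forall>m. (\<Sum>k\<in>UNIV. w k m) * x m = (\<Sum>k\<in>UNIV. w m k * x k))"

definition arc_set :: "('a \<Rightarrow> 'a \<Rightarrow> real) \<Rightarrow> 'a rel" where
  "arc_set w = {(i, j). w i j > 0}"

lemma laplacian_kernel_iff_harmonic:
  fixes w :: "'n::finite \<Rightarrow> 'n \<Rightarrow> real"
  assumes "\<And>i. w i i = 0"
  shows "laplacian w *v x = 0 \<longleftrightarrow> harmonic w (\<lambda>m. x $ m)"
proof -
  have "(laplacian w *v x) $ m = (\<Sum>k\<in>UNIV. w k m) * x $ m - (\<Sum>k\<in>UNIV. w m k * x $ k)" for m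
  proof -
    have "(laplacian w *v x) $ m = (\<Sum>j\<in>UNIV. laplacian w $ m $ j * x $ j)"
      by (simp add: matrix_vector_mult_def)
    also have "\<dots> = laplacian w $ m $ m * x $ m + (\<Sum>j\<in>UNIV - {m}. laplacian w $ m $ j * x $ j)"
      by (rule sum.remove) auto
    also have "laplacian w $ m $ m = (\<Sum>k\<in>UNIV. w k m)"
      using assms by (simp add: laplacian_def sum.remove[of UNIV m "\<lambda>k. w k m"])
    also have "(\<Sum>j\<in>UNIV - {m}. laplacian w $ m $ j * x $ j) = (\<Sum>j\<in>UNIV - {m}. - (w m j * x $ j))"
      by (rule sum.cong) (auto simp: laplacian_def)
    also have "\<dots> = - (\<Sum>j\<in>UNIV. w m j * x $ j)"
      using assms by (simp add: sum_negf sum.remove[of UNIV m "\<lambda>j. w m j * x $ j"])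
    finally show ?thesis by simp
  qed
  then show ?thesis by (simp add: vec_eq_iff harmonic_def)
qed

lemma harmonic_diff:
  "harmonic w x \<Longrightarrow> harmonic w y \<Longrightarrow> harmonic w (\<lambda>m. x m - y m)"
  by (simp add: harmonic_def right_diff_distrib sum_subtractf)

lemma harmonic_scale: "harmonic w x \<Longrightarrow> harmonic w (\<lambda>m. c * x m)"
  by (simp add: harmonic_def mult.left_commute[of _ c] flip: sum_distrib_left)

lemma harmonic_sum:
  "(\<And>s. s \<in> S \<Longrightarrow> harmonic w (x s)) \<Longrightarrow> harmonic w (\<lambda>m. \<Sum>s\<in>S. x s m)"
  unfolding harmonic_def by (simp add: sum_distrib_left sum.swap[of _ S])

text \<open>The triangle inequality gives the balance equations for \<open>\<bar>x\<bar>\<close> as inequalities; summed over all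
  vertices, they become equalities because the columns of the Laplacian sum to zero.\<close>
lemma harmonic_abs:
  assumes nonneg: "\<And>i j. 0 \<le> w i j" and x: "harmonic w x"
  shows "harmonic w (\<lambda>m. \<bar>x m\<bar>)"
proof -
  have le: "(\<Sum>k\<in>UNIV. w k m) * \<bar>x m\<bar> \<le> (\<Sum>k\<in>UNIV. w m k * \<bar>x k\<bar>)" for m
  proof -
    have "(\<Sum>k\<in>UNIV. w k m) * \<bar>x m\<bar> = \<bar>(\<Sum>k\<in>UNIV. w k m) * x m\<bar>"
      using nonneg by (simp add: abs_mult sum_nonneg)
    also have "\<dots> = \<bar>\<Sum>k\<in>UNIV. w m k * x k\<bar>" using x by (simp add: harmonic_def)
    also have "\<dots> \<le> (\<Sum>k\<in>UNIV. \<bar>w m k * x k\<bar>)" by (rule sum_abs)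
    finally show ?thesis using nonneg by (simp add: abs_mult)
  qed
  have eq: "(\<Sum>m\<in>UNIV. (\<Sum>k\<in>UNIV. w k m) * \<bar>x m\<bar>) = (\<Sum>m\<in>UNIV. \<Sum>k\<in>UNIV. w m k * \<bar>x k\<bar>)"
    unfolding sum_distrib_right by (rule sum.swap)
  have "(\<Sum>k\<in>UNIV. w k m) * \<bar>x m\<bar> = (\<Sum>k\<in>UNIV. w m k * \<bar>x k\<bar>)" for m
    by (rule sum_mono_inv[OF eq]) (use le in auto)
  then show ?thesis by (simp add: harmonic_def)
qed

section \<open>Supports of kernel vectors\<close>

lemma harmonic_support_pred:
  assumes nonneg: "\<And>i j. 0 \<le> w i j" and x: "harmonic w x" and "x j \<noteq> 0" "0 < w m j"
  shows "x m \<noteq> 0"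
proof
  assume "x m = 0"
  then have "(\<Sum>k\<in>UNIV. w m k * \<bar>x k\<bar>) = 0"
    using harmonic_abs[OF nonneg x] unfolding harmonic_def by (metis abs_zero mult_zero_right)
  then have "w m j * \<bar>x j\<bar> = 0"
    using nonneg by (subst (asm) sum_nonneg_eq_0_iff) auto
  then show False using assms(3,4) by simp
qed

lemma harmonic_support_pred_rtrancl:
  assumes nonneg: "\<And>i j. 0 \<le> w i j" and x: "harmonic w x"
    and "(m, j) \<in> (arc_set w)\<^sup>*" "x j \<noteq> 0"
  shows "x m \<noteq> 0"
  using assms(3,4)
  by (induction rule: converse_rtrancl_induct)
    (auto simp: arc_set_def dest: harmonic_support_pred[OF nonneg x])

text \<open>Sum the balance equations of \<open>\<bar>x\<bar>\<close> over \<open>C\<close>. The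
  contributions of the vertices in \<open>C\<close> cancel, and what is left is a sum of nonnegative
  terms over the outside vertices with an arc from \<open>C\<close>.\<close>

lemma harmonic_no_escape:
  assumes nonneg: "\<And>i j. 0 \<le> w i j" and x: "harmonic w x"
    and closed: "\<And>u v. 0 < w u v \<Longrightarrow> v \<in> C \<Longrightarrow> u \<in> C"
    and m: "m \<in> C" and j: "j \<notin> C" "0 < w m j"
  shows "x j = 0"
proof -
  have abs: "(\<Sum>k\<in>UNIV. w k i) * \<bar>x i\<bar> = (\<Sum>k\<in>UNIV. w i k * \<bar>x k\<bar>)" for i
    using harmonic_abs[OF nonneg x] by (simp add: harmonic_def)
  \<comment> \<open>All arcs into a vertex of \<open>C\<close> start in \<open>C\<close>, so
    restricting the sum to \<open>C\<close> loses nothing.\<close>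
  have inflow: "(\<Sum>i\<in>C. w i k) = (\<Sum>i\<in>UNIV. w i k)" if "k \<in> C" for k
  proof (rule sum.mono_neutral_left)
    show "\<forall>i\<in>UNIV - C. w i k = 0"
      using closed[OF _ that] nonneg by (metis DiffD2 order_le_less)
  qed auto
  have "(\<Sum>k\<in>C. (\<Sum>i\<in>UNIV. w i k) * \<bar>x k\<bar>) = (\<Sum>i\<in>C. \<Sum>k\<in>UNIV. w i k * \<bar>x k\<bar>)"
    by (simp add: abs)
  also have "\<dots> = (\<Sum>k\<in>UNIV. (\<Sum>i\<in>C. w i k) * \<bar>x k\<bar>)"
    unfolding sum_distrib_right by (rule sum.swap)
  also have "\<dots> = (\<Sum>k\<in>C. (\<Sum>i\<in>C. w i k) * \<bar>x k\<bar>) + (\<Sum>k\<in>- C. (\<Sum>i\<in>C. w i k) * \<bar>x k\<bar>)"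
    using sum.union_disjoint[of C "- C" "\<lambda>k. (\<Sum>i\<in>C. w i k) * \<bar>x k\<bar>"] by (simp add: Compl_partition)
  also have "(\<Sum>k\<in>C. (\<Sum>i\<in>C. w i k) * \<bar>x k\<bar>) = (\<Sum>k\<in>C. (\<Sum>i\<in>UNIV. w i k) * \<bar>x k\<bar>)"
    by (simp add: inflow)
  finally have "(\<Sum>k\<in>- C. (\<Sum>i\<in>C. w i k) * \<bar>x k\<bar>) = 0" by simp
  then have "(\<Sum>i\<in>C. w i j) * \<bar>x j\<bar> = 0"
    using nonneg j(1) by (subst (asm) sum_nonneg_eq_0_iff) (auto simp: sum_nonneg)
  moreover have "0 < (\<Sum>i\<in>C. w i j)"
    using m j(2) nonneg by (intro sum_pos2[of C m]) auto
  ultimately show ?thesis by simp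
qed

text \<open>If \<open>m\<close> does not reach some predecessor \<open>m'\<close>, the path from
  \<open>m'\<close> to \<open>m\<close> leaves the predecessor set \<open>C\<close> of
  \<open>m'\<close> along an arc. The head of this arc precedes \<open>m\<close>, hence lies in the
  support, which contradicts \<open>harmonic_no_escape\<close>.\<close>

lemma harmonic_support_knots:
  assumes nonneg: "\<And>i j. 0 \<le> w i j" and x: "harmonic w x" and "x m \<noteq> 0"
  shows "m \<in> \<Union>(knots (arc_set w))"
proof -
  let ?E = "arc_set w"
  have "(m, m') \<in> ?E\<^sup>*" if m': "(m', m) \<in> ?E\<^sup>*" for m'
  proof (rule ccontr)
    assume "(m, m') \<notin> ?E\<^sup>*"
    define C where "C = {u. (u, m') \<in> ?E\<^sup>*}"
    have closed: "u \<in> C" if "0 < w u v" "v \<in> C" for u v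
      using that by (auto simp: C_def arc_set_def intro: converse_rtrancl_into_rtrancl)
    \<comment> \<open>Membership in \<open>C\<close> is carried along the path arc by arc, as no arc
      towards the support can leave \<open>C\<close>.\<close>
    from m' have "m' \<in> C \<longrightarrow> m \<in> C"
    proof (induction rule: converse_rtrancl_induct)
      case (step a b)
      show ?case
      proof
        assume "a \<in> C"
        have "x b \<noteq> 0"
          using harmonic_support_pred_rtrancl[OF nonneg x step.hyps(2)] assms(3) by blast
        moreover have "0 < w a b" using step.hyps(1) by (simp add: arc_set_def)
        ultimately have "b \<in> C"
          using harmonic_no_escape[of w x C a b] nonneg x closed \<open>a \<in> C\<close> by blast
        then show "m \<in> C" using step.IH by blast
      qed
    qed simp
    then show False using \<open>(m, m') \<notin> ?E\<^sup>*\<close> by (simp add: C_def)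
  qed
  then have "{u. (u, m) \<in> ?E\<^sup>*} \<in> knots ?E" unfolding knots_def by blast
  then show ?thesis by blast
qed

text \<open>Vertices of one knot all precede each other, so the support is a union of whole knots
  and one zero clears a knot. Applied to a difference, this shows that a kernel vector is determined
  by one value per knot.\<close>

lemma harmonic_eq_0:
  assumes nonneg: "\<And>i j. 0 \<le> w i j" and x: "harmonic w x"
    and zero: "\<And>K. K \<in> knots (arc_set w) \<Longrightarrow> \<exists>j\<in>K. x j = 0"
  shows "x m = 0"
proof (rule ccontr)
  assume m: "x m \<noteq> 0"
  then obtain K where K: "K \<in> knots (arc_set w)" "m \<in> K"
    using harmonic_support_knots[OF nonneg x] by blast
  then obtain j where "j \<in> K" "x j = 0" using zero by blast
  then show False
    using harmonic_support_pred_rtrancl[OF nonneg x knot_connected[OF K(1)]] K(2) m by blast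
qed

section \<open>The matrix of maximum out-forests\<close>

definition tree_weight :: "('a::finite \<Rightarrow> 'a \<Rightarrow> real) \<Rightarrow> 'a set \<Rightarrow> 'a \<Rightarrow> real" where
  "tree_weight w K i = (\<Sum>T\<in>arborescences (arc_set w) K i. arc_weight w T)"

lemma arc_weight_pos: "A \<subseteq> arc_set w \<Longrightarrow> 0 < arc_weight w A"
  unfolding arc_weight_def by (rule prod_pos) (auto simp: arc_set_def)

text \<open>Some maximum branching has \<open>i\<close> as a root, and its restriction to
  \<open>K\<close> is a tree rooted at \<open>i\<close>.\<close>

lemma tree_weight_pos:
  assumes "K \<in> knots (arc_set w)" "i \<in> K"
  shows "0 < tree_weight w K i"
proof -
  obtain A where "A \<in> max_branchings (arc_set w)" "i \<notin> Range A"
    using max_branching_with_root[OF assms] .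
  then have "arborescences (arc_set w) K i \<noteq> {}"
    using max_branching_restrict assms by fastforce
  then show ?thesis
    unfolding tree_weight_def
    by (intro sum_pos arc_weight_pos) (auto simp: arborescences_def)
qed

text \<open>At a vertex of a knot \<open>K\<close>, only arcs inside \<open>K\<close> contribute to
  either side, and the equation is a multiple of the Markov chain tree theorem. At a vertex outside
  all knots, every arc leads to a vertex outside all knots, where \<open>x\<close> vanishes.\<close>

lemma harmonic_if_proportional_on_knots:
  assumes nonneg: "\<And>i j. 0 \<le> w i j"
    and out: "\<And>i. i \<notin> \<Union>(knots (arc_set w)) \<Longrightarrow> x i = 0"
    and proportional: "\<And>K. K \<in> knots (arc_set w) \<Longrightarrow> \<exists>c. \<forall>i\<in>K. x i = c * tree_weight w K i"
  shows "harmonic w x"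
proof -
  have arc: "w u v = 0" if "(u, v) \<notin> arc_set w" for u v
    using that nonneg[of u v] by (simp add: arc_set_def)
  have "(\<Sum>k\<in>UNIV. w k m) * x m = (\<Sum>k\<in>UNIV. w m k * x k)" for m
  proof (cases "m \<in> \<Union>(knots (arc_set w))")
    case True
    then obtain K where K: "K \<in> knots (arc_set w)" "m \<in> K" by blast
    obtain c where c: "\<forall>i\<in>K. x i = c * tree_weight w K i" using proportional[OF K(1)] by blast
    have in_eq: "(\<Sum>k\<in>UNIV. w k m) = (\<Sum>k\<in>{k \<in> K. (k, m) \<in> arc_set w}. w k m)"
      by (rule sum.mono_neutral_right) (use knot_pred_closed[OF K(1) _ K(2)] arc in auto)
    \<comment> \<open>If \<open>k\<close> lies in a knot, the arc from \<open>m\<close> forces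
      \<open>m\<close> into that knot, which is then \<open>K\<close>.\<close>
    have "w m k * x k = 0" if "k \<notin> {k \<in> K. (m, k) \<in> arc_set w}" for k
    proof (cases "(m, k) \<in> arc_set w \<and> k \<in> \<Union>(knots (arc_set w))")
      case True
      then obtain K' where K': "K' \<in> knots (arc_set w)" "k \<in> K'" by blast
      then have "m \<in> K'" using True knot_pred_closed by metis
      then have "K' = K" using knot_eqI K K' by metis
      then show ?thesis using that True K' by blast
    next
      case False
      then show ?thesis using arc out by auto
    qed
    then have "(\<Sum>k\<in>UNIV. w m k * x k) = (\<Sum>k\<in>{k \<in> K. (m, k) \<in> arc_set w}. w m k * x k)"
      by (intro sum.mono_neutral_right) auto
    also have "\<dots> = c * (\<Sum>k\<in>{k \<in> K. (m, k) \<in> arc_set w}. w m k * tree_weight w K k)"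
      using c unfolding sum_distrib_left by (intro sum.cong) auto
    also have "\<dots> = (\<Sum>k\<in>{k \<in> K. (k, m) \<in> arc_set w}. w k m) * x m"
      using markov_chain_tree[where E = "arc_set w" and w = w, OF K(2)] c K(2)
      unfolding tree_weight_def[symmetric] by (simp flip: mult.assoc add: mult.commute)
    finally show ?thesis using in_eq by simp
  next
    case False
    have "w m k * x k = 0" for k
    proof (cases "(m, k) \<in> arc_set w")
      case True
      then have "k \<notin> \<Union>(knots (arc_set w))" using False knot_pred_closed by (metis UnionE UnionI)
      then show ?thesis using out by simp
    qed (simp add: arc)
    then have "(\<Sum>k\<in>UNIV. w m k * x k) = 0" by (intro sum.neutral) blast
    then show ?thesis using out[OF False] by simp
  qed
  then show ?thesis by (simp add: harmonic_def)
qed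

section \<open>Graph weights as sums over relations\<close>

lemma digraph_of_conv: "digraph_of w = arc_digraph UNIV (arc_set w)"
  by (simp add: digraph_of_def arc_digraph_def arc_set_def)

lemma set_weight_arc_digraph: "set_weight w (arc_digraph V ` S) = (\<Sum>A\<in>S. arc_weight w A)"
  by (simp add: set_weight_def sum.reindex inj_on_def weight_def arc_weight_def)

lemma spanning_diverging_trees_at_arc_digraph:
  fixes E :: "('a::finite) rel"
  shows "spanning_diverging_trees_at (arc_digraph UNIV E \<restriction> K) i = arc_digraph K ` arborescences E K i"
proof -
  have restrict: "arc_digraph UNIV E \<restriction> K = arc_digraph K (E \<inter> K \<times> K)"
    by (auto simp: induce_subgraph_def arc_digraph_def)
  have "spanning T (arc_digraph K (E \<inter> K \<times> K)) \<longleftrightarrow> (\<exists>A\<subseteq>E \<inter> K \<times> K. T = arc_digraph K A)" for T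
    by (rule spanning_arc_digraph_iff) simp
  moreover have "diverging_tree (arc_digraph K A) i \<longleftrightarrow> arborescence K i A" if "A \<subseteq> E \<inter> K \<times> K" for A
    using that by (intro diverging_tree_arc_digraph_iff) auto
  ultimately show ?thesis
    unfolding spanning_diverging_trees_at_def arborescences_def restrict
    by (auto simp: arborescence_def)
qed

lemma set_weight_spanning_diverging_trees_at:
  "set_weight w (spanning_diverging_trees_at (digraph_of w \<restriction> K) i) = tree_weight w K i"
  by (simp add: digraph_of_conv spanning_diverging_trees_at_arc_digraph set_weight_arc_digraph
      tree_weight_def)

text \<open>The trees are sorted by their root, which is unique.\<close>

lemma set_weight_spanning_diverging_trees:
  "set_weight w (spanning_diverging_trees (digraph_of w \<restriction> K)) = (\<Sum>i\<in>K. tree_weight w K i)"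
proof -
  have "spanning_diverging_trees G = (\<Union>i. spanning_diverging_trees_at G i)" for G :: "('a, 'a \<times> 'a) pre_digraph"
    by (auto simp: spanning_diverging_trees_def spanning_diverging_trees_at_def)
  then have "spanning_diverging_trees (digraph_of w \<restriction> K)
      = arc_digraph K ` (\<Union>i. arborescences (arc_set w) K i)"
    by (simp add: digraph_of_conv spanning_diverging_trees_at_arc_digraph image_UN)
  moreover have "(\<Union>i. arborescences (arc_set w) K i) = (\<Union>i\<in>K. arborescences (arc_set w) K i)"
    by (auto simp: arborescences_def arborescence_def)
  moreover have "(\<Sum>T\<in>(\<Union>i\<in>K. arborescences (arc_set w) K i). arc_weight w T)
      = (\<Sum>i\<in>K. tree_weight w K i)"
    unfolding tree_weight_def
    by (rule sum.UNION_disjoint) (auto simp: arborescences_def dest: arborescence_root_unique)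
  ultimately show ?thesis by (simp add: set_weight_arc_digraph)
qed

lemma max_forest_matrix_conv:
  "max_forest_matrix w $ i $ j =
    (\<Sum>A\<in>{A \<in> max_branchings (arc_set w). i \<notin> Range A \<and> (i, j) \<in> A\<^sup>*}. arc_weight w A)
      / (\<Sum>A\<in>max_branchings (arc_set w). arc_weight w A)"
  by (simp add: max_forest_matrix_def digraph_of_conv max_out_forests_from_to_arc_digraph
      max_out_forests_arc_digraph set_weight_arc_digraph)

text \<open>For fixed \<open>j\<close> and \<open>K\<close>, the weight of the remainders divided by
  the total weight is the same for all roots \<open>i\<close> in \<open>K\<close>, so it serves as
  the factor of proportionality.\<close>

lemma harmonic_max_forest_matrix:
  assumes nonneg: "\<And>i j. 0 \<le> w i j"
  shows "harmonic w (\<lambda>i. max_forest_matrix w $ i $ j)"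
proof (rule harmonic_if_proportional_on_knots[OF nonneg])
  fix i assume "i \<notin> \<Union>(knots (arc_set w))"
  then have none: "{A \<in> max_branchings (arc_set w). i \<notin> Range A \<and> (i, j) \<in> A\<^sup>*} = {}"
    using max_branchingsD(3)[of _ "arc_set w"] by (metis (no_types, lifting) ComplI empty_Collect_eq subsetD)
  show "max_forest_matrix w $ i $ j = 0"
    unfolding max_forest_matrix_conv none by simp
next
  fix K assume K: "K \<in> knots (arc_set w)"
  show "\<exists>c. \<forall>i\<in>K. max_forest_matrix w $ i $ j = c * tree_weight w K i"
    by (intro exI[of _ "(\<Sum>B\<in>rest_branchings (arc_set w) K j. arc_weight w B)
        / (\<Sum>A\<in>max_branchings (arc_set w). arc_weight w A)"] ballI)
      (simp add: max_forest_matrix_conv sum_max_branchings_decompose[OF K] tree_weight_def)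
qed

text \<open>For \<open>j\<close> in \<open>K\<close> the root above \<open>j\<close> always lies in
  \<open>K\<close>. The maximum branchings are thus partitioned by their root in \<open>K\<close>,
  and the weight \<open>\<rho>\<close> of the remainders cancels from numerator and
  denominator.\<close>

lemma max_forest_matrix_knot_column:
  assumes K: "K \<in> knots (arc_set w)" and j: "j \<in> K"
  shows "max_forest_matrix w $ i $ j
    = (if i \<in> K then tree_weight w K i / (\<Sum>k\<in>K. tree_weight w K k) else 0)"
proof -
  let ?M = "max_branchings (arc_set w)"
  define S where "S i = {A \<in> ?M. i \<notin> Range A \<and> (i, j) \<in> A\<^sup>*}" for i
  define \<rho> where "\<rho> = (\<Sum>B\<in>rest_branchings (arc_set w) K j. arc_weight w B)"
  have in_K: "i \<in> K" if "A \<in> S i" for A i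
  proof -
    have "(i, j) \<in> (arc_set w)\<^sup>*"
      using that max_branchingsD(1) rtrancl_mono unfolding S_def by blast
    then show ?thesis using K j by (rule knot_pred_closed_rtrancl)
  qed
  have S_sum: "(\<Sum>A\<in>S i. arc_weight w A) = tree_weight w K i * \<rho>" if "i \<in> K" for i
    unfolding S_def \<rho>_def tree_weight_def by (rule sum_max_branchings_decompose[OF K that])
  have "?M = (\<Union>k\<in>K. S k)"
  proof (intro subset_antisym subsetI)
    fix A assume A: "A \<in> ?M"
    obtain r where "r \<notin> Range A" "(r, j) \<in> A\<^sup>*"
      using branching_root_exists[OF max_branchingsD(2)[OF A]] by (metis finite)
    then have "A \<in> S r" using A by (simp add: S_def)
    then show "A \<in> (\<Union>k\<in>K. S k)" using in_K by blast
  qed (auto simp: S_def)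
  moreover have "S k \<inter> S k' = {}" if "k \<in> K" "k' \<in> K" "k \<noteq> k'" for k k'
    using that max_branchingsD(4)[OF _ K] unfolding S_def by blast
  ultimately have "(\<Sum>A\<in>?M. arc_weight w A) = (\<Sum>k\<in>K. \<Sum>A\<in>S k. arc_weight w A)"
    by (simp add: sum.UNION_disjoint)
  also have "\<dots> = (\<Sum>k\<in>K. tree_weight w K k) * \<rho>"
    by (simp add: S_sum sum_distrib_right)
  finally have total: "(\<Sum>A\<in>?M. arc_weight w A) = (\<Sum>k\<in>K. tree_weight w K k) * \<rho>" .
  \<comment> \<open>Positivity of the total weight excludes \<open>\<rho> = 0\<close> and allows the
    cancellation.\<close>
  have "0 < (\<Sum>A\<in>?M. arc_weight w A)"
    using max_branchings_nonempty max_branchingsD(1) by (intro sum_pos arc_weight_pos) auto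
  then have "\<rho> \<noteq> 0" using total by auto
  show ?thesis
  proof (cases "i \<in> K")
    case True
    then show ?thesis
      using S_sum[OF True] \<open>\<rho> \<noteq> 0\<close> unfolding max_forest_matrix_conv total S_def by simp
  next
    case False
    then have "S i = {}" using in_K by blast
    then have none: "{A \<in> ?M. i \<notin> Range A \<and> (i, j) \<in> A\<^sup>*} = {}" by (simp only: S_def)
    show ?thesis using False unfolding max_forest_matrix_conv none by simp
  qed
qed

section \<open>Orthogonal basis of the kernel from one column per source knot\<close>

theorem theorem6:
  fixes w :: "'n::finite \<Rightarrow> 'n \<Rightarrow> real"
  assumes "CARD('n) > 1"
    and "weighted_digraph w"
  shows "(\<forall>j. laplacian w *v column j (max_forest_matrix w) = 0) \<and>
    (\<forall>(K :: nat \<Rightarrow> 'n set) (num :: 'n \<Rightarrow> nat) (i :: nat \<Rightarrow> nat) (k :: nat \<Rightarrow> nat) (j :: nat \<Rightarrow> 'n).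
      bij_betw K {1..out_forest_dim (digraph_of w)} (source_knots (digraph_of w)) \<longrightarrow>
      standard_numeration num (out_forest_dim (digraph_of w)) K \<longrightarrow>
      (\<forall>s\<in>{1..out_forest_dim (digraph_of w)}. num ` K s = {i s + 1..i s + k s}) \<longrightarrow>
      (\<forall>s\<in>{1..out_forest_dim (digraph_of w)}. j s \<in> K s) \<longrightarrow>
      (let d = out_forest_dim (digraph_of w);
           J = max_forest_matrix w;
           B = (\<lambda>s. column (j s) J) ` {1..d}
       in inj_on (\<lambda>s. column (j s) J) {1..d}
        \<and> pairwise orthogonal B
        \<and> independent B
        \<and> span B = {x. laplacian w *v x = 0}
        \<and> (\<forall>s\<in>{1..d}.
            column (j s) J =
              inverse (set_weight w (spanning_diverging_trees (digraph_of w \<restriction> K s))) *\<^sub>R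
              (\<chi> m. if num m \<in> {i s + 1..i s + k s}
                    then set_weight w (spanning_diverging_trees_at (digraph_of w \<restriction> K s) m)
                    else 0)
            \<and> (\<forall>m. column (j s) J $ m \<noteq> 0 \<longleftrightarrow> num m \<in> {i s + 1..i s + k s}))))"
proof (intro conjI allI impI)
  have nonneg: "\<And>i j. 0 \<le> w i j" and loopfree: "\<And>i. w i i = 0"
    using assms(2) by (simp_all add: weighted_digraph_def)
  note kernel_iff = laplacian_kernel_iff_harmonic[of w, OF loopfree]
  have kernel: "laplacian w *v column j (max_forest_matrix w) = 0" for j
    using harmonic_max_forest_matrix[OF nonneg] by (simp add: kernel_iff column_def)
  then show "laplacian w *v column j (max_forest_matrix w) = 0" for j .
  fix K :: "nat \<Rightarrow> 'n set" and num :: "'n \<Rightarrow> nat" and i k :: "nat \<Rightarrow> nat" and j :: "nat \<Rightarrow> 'n"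
  let ?d = "out_forest_dim (digraph_of w)"
  let ?J = "max_forest_matrix w"
  let ?B = "(\<lambda>s. column (j s) ?J) ` {1..?d}"
  assume bij: "bij_betw K {1..?d} (source_knots (digraph_of w))"
    and num: "standard_numeration num ?d K"
    and numK: "\<forall>s\<in>{1..?d}. num ` K s = {i s + 1..i s + k s}"
    and jK: "\<forall>s\<in>{1..?d}. j s \<in> K s"
  have knots: "source_knots (digraph_of w) = knots (arc_set w)"
    by (simp add: digraph_of_conv source_knots_arc_digraph)
  have K: "K s \<in> knots (arc_set w)" if "s \<in> {1..?d}" for s
    using bij that unfolding knots by (rule bij_betwE[rule_format])
  have disj: "s = t" if "s \<in> {1..?d}" "t \<in> {1..?d}" "m \<in> K s" "m \<in> K t" for s t m
    using inj_onD[OF bij_betw_imp_inj_on[OF bij] knot_eqI[OF K K] that(1,2)] that by blast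
  \<comment> \<open>Injectivity of \<open>num\<close> turns the block of positions back into the
    knot.\<close>
  have num_iff: "num m \<in> {i s + 1..i s + k s} \<longleftrightarrow> m \<in> K s" if "s \<in> {1..?d}" for s m
  proof -
    have "inj num"
      using num by (auto simp: standard_numeration_def bij_betw_def)
    then show ?thesis
      using numK that by (metis inj_image_mem_iff)
  qed
  have sum_pos: "0 < (\<Sum>m\<in>K s. tree_weight w (K s) m)" if "s \<in> {1..?d}" for s
    using K[OF that] jK that by (intro sum_pos tree_weight_pos) auto
  have col: "column (j s) ?J $ m
      = (if m \<in> K s then tree_weight w (K s) m / (\<Sum>m\<in>K s. tree_weight w (K s) m) else 0)"
    if "s \<in> {1..?d}" for s m
    using max_forest_matrix_knot_column[OF K[OF that]] jK that by (simp add: column_def)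
  \<comment> \<open>The support of the column is exactly the knot, because tree weights are
    positive. Disjointness of the knots then yields injectivity, orthogonality and, all columns
    being nonzero, independence.\<close>
  have nonzero: "column (j s) ?J $ m \<noteq> 0 \<longleftrightarrow> m \<in> K s" if "s \<in> {1..?d}" for s m
    using col[OF that, of m] sum_pos[OF that] tree_weight_pos[OF K[OF that], of m] by auto
  have inj: "inj_on (\<lambda>s. column (j s) ?J) {1..?d}"
  proof (rule inj_onI)
    fix s t assume st: "s \<in> {1..?d}" "t \<in> {1..?d}" and eq: "column (j s) ?J = column (j t) ?J"
    have "j s \<in> K s" using jK st(1) by blast
    moreover have "j s \<in> K t"
      using nonzero[OF st(1)] nonzero[OF st(2)] eq \<open>j s \<in> K s\<close> by metis
    ultimately show "s = t" by (rule disj[OF st])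
  qed
  have orth: "pairwise orthogonal ?B"
  proof (rule pairwise_imageI)
    fix s t assume st: "s \<in> {1..?d}" "t \<in> {1..?d}" "s \<noteq> t"
    have "column (j s) ?J $ m * column (j t) ?J $ m = 0" for m
      using nonzero[OF st(1)] nonzero[OF st(2)] disj[OF st(1,2)] st(3) by (metis mult_eq_0_iff)
    then show "orthogonal (column (j s) ?J) (column (j t) ?J)"
      unfolding orthogonal_def inner_vec_def inner_real_def by (intro sum.neutral) blast
  qed
  have "0 \<notin> ?B"
  proof
    assume "0 \<in> ?B"
    then obtain s where s: "s \<in> {1..?d}" "column (j s) ?J = 0" by force
    then show False using nonzero[OF s(1), of "j s"] jK by simp
  qed
  then have indep: "independent ?B"
    by (rule pairwise_orthogonal_independent[OF orth])
  have "span ?B = {x. laplacian w *v x = 0}"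
  proof (intro subset_antisym subsetI)
    fix x assume "x \<in> span ?B"
    moreover have "subspace {x. laplacian w *v x = 0}"
      by (auto simp: subspace_def matrix_vector_right_distrib matrix_vector_mult_scaleR)
    ultimately show "x \<in> {x. laplacian w *v x = 0}"
      using kernel by (elim span_induct) auto
  next
    fix x assume "x \<in> {x. laplacian w *v x = 0}"
    then have x: "harmonic w (\<lambda>m. x $ m)" by (simp add: kernel_iff)
    \<comment> \<open>The coefficients make \<open>y\<close> agree with \<open>x\<close> at every
      \<open>j s\<close>; the divisor is nonzero because \<open>j s\<close> lies in its own
      knot.\<close>
    define c where "c s = x $ j s / column (j s) ?J $ j s" for s
    define y where "y = (\<Sum>s\<in>{1..?d}. c s *\<^sub>R column (j s) ?J)"
    have y: "y $ m = (\<Sum>s\<in>{1..?d}. c s * column (j s) ?J $ m)" for m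
      by (simp add: y_def)
    have "harmonic w (\<lambda>m. column (j s) ?J $ m)" for s
      using kernel kernel_iff by blast
    then have "harmonic w (\<lambda>m. y $ m)"
      unfolding y by (intro harmonic_sum) (rule harmonic_scale)
    then have "harmonic w (\<lambda>m. x $ m - y $ m)"
      by (rule harmonic_diff[OF x])
    moreover have "\<exists>u\<in>K'. x $ u - y $ u = 0" if "K' \<in> knots (arc_set w)" for K'
    proof -
      have "K' \<in> K ` {1..?d}"
        using that bij_betw_imp_surj_on[OF bij] unfolding knots by simp
      then obtain s where s: "s \<in> {1..?d}" "K' = K s" by blast
      have js: "j s \<in> K s" using jK s(1) by blast
      \<comment> \<open>The other columns are supported on other knots, so only the summand of
        \<open>s\<close> survives at \<open>j s\<close>.\<close>
      have "column (j t) ?J $ j s = 0" if "t \<in> {1..?d} - {s}" for t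
        using nonzero[of t "j s"] disj[of t s "j s"] that js s(1) by (metis DiffE insertI1)
      then have "y $ j s = c s * column (j s) ?J $ j s"
        unfolding y using sum.remove[OF _ s(1), of "\<lambda>t. c t * column (j t) ?J $ j s"] by simp
      also have "\<dots> = x $ j s"
        using nonzero[OF s(1)] js by (simp add: c_def)
      finally show ?thesis using js s(2) by (intro bexI[of _ "j s"]) simp_all
    qed
    ultimately have "x $ m - y $ m = 0" for m
      by (rule harmonic_eq_0[OF nonneg])
    then have "x = y" by (simp add: vec_eq_iff)
    then show "x \<in> span ?B"
      unfolding y_def by (auto intro!: span_sum span_scale intro: span_base)
  qed
  moreover have "column (j s) ?J =
      inverse (set_weight w (spanning_diverging_trees (digraph_of w \<restriction> K s))) *\<^sub>R
        (\<chi> m. if num m \<in> {i s + 1..i s + k s}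
              then set_weight w (spanning_diverging_trees_at (digraph_of w \<restriction> K s) m) else 0)"
    if "s \<in> {1..?d}" for s
    unfolding num_iff[OF that] set_weight_spanning_diverging_trees
      set_weight_spanning_diverging_trees_at
    using col[OF that] by (simp add: vec_eq_iff divide_inverse mult.commute)
  ultimately show "let d = ?d; J = ?J; B = (\<lambda>s. column (j s) J) ` {1..d}
       in inj_on (\<lambda>s. column (j s) J) {1..d}
        \<and> pairwise orthogonal B
        \<and> independent B
        \<and> span B = {x. laplacian w *v x = 0}
        \<and> (\<forall>s\<in>{1..d}.
            column (j s) J =
              inverse (set_weight w (spanning_diverging_trees (digraph_of w \<restriction> K s))) *\<^sub>R
              (\<chi> m. if num m \<in> {i s + 1..i s + k s}
                    then set_weight w (spanning_diverging_trees_at (digraph_of w \<restriction> K s) m)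
                    else 0)
            \<and> (\<forall>m. column (j s) J $ m \<noteq> 0 \<longleftrightarrow> num m \<in> {i s + 1..i s + k s}))"
    unfolding Let_def using inj orth indep nonzero num_iff by blast
qed

end
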